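(* Let $A,f,\mathcal H,\mathcal Y,n,\mu_0,\psi_0,\psi_0^*$ satisfy the Basic Assumption and let $\mathcal C$ be an antilinear symmetry of $A$ and $f$, both as stated in the context. Suppose in addition that $\mu_0\in\mathbb R$ and that the eigenvector $\psi_0$ is chosen $\mathcal C$-symmetric, i.e. $\mathcal C\psi_0=\psi_0$. Then there is $\varepsilon_0>0$ such that, for all $\varepsilon\in(-\varepsilon_0,\varepsilon_0)$, the nonlinear eigenpair $(\mu,\psi)=(\mu(\varepsilon),\psi(\varepsilon))$ defined in the context exists (uniquely, in the sense described there) and satisfies $$\mu\in\mathbb R\qquad\text{and}\qquad \mathcal C\psi=\psi .$$
   Context: Basic Assumption. $A$ is a densely defined closed operator with non-empty resolvent set in a complex Hilbert space $(\mathcal H,\langle\cdot,\cdot\rangle)$ (inner product linear in the first argument) with induced norm $\|\cdot\|$; $f$ is a (generally nonlinear) mapping in $\mathcal H$; $(\mathcal Y,\|\cdot\|_{\mathcal Y})$ is a Banach space; and for $m\in\mathbb N_0$, $\|\phi\|_m:=\sum_{k=0}^m\|A^k\phi\|$ for $\phi\in\operatorname{Dom}(A^m)$ (with $A^0=I$). The following are assumed: (a) $\mathcal Y$ is a linear subspace of $\mathcal H$, for some $n\in\mathbb N$, $n\ge1$, one has $\operatorname{Dom}(A^n)\subset\mathcal Y\subset\operatorname{Dom}(A^{n-1})$, and there are $k_1,k_2>0$ such that $\|\phi\|_{n-1}\le k_1\|\phi\|_{\mathcal Y}\le k_2\|\phi\|_n$ for all $\phi\in\operatorname{Dom}(A^n)$.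 (b) $\mu_0\in\mathbb C$ is an isolated eigenvalue of $A$ that is simple, i.e. of algebraic multiplicity one; $\psi_0\in\operatorname{Dom}(A)$, $\psi_0^*\in\operatorname{Dom}(A^* )$ satisfy $A\psi_0=\mu_0\psi_0$, $A^*\psi_0^*=\overline{\mu_0}\psi_0^*$, $\|\psi_0\|=1$, $\langle\psi_0,\psi_0^*\rangle=1$. (c) $f:\mathcal Y\to\operatorname{Dom}(A^{n-1})$ and there exist $r_L>0$, $L>0$ such that $\|f(\phi)-f(\psi)\|_{n-1}\le k_1L\|\phi-\psi\|_{\mathcal Y}$ for all $\phi,\psi\in\{\eta\in\mathcal Y:\|\eta-\psi_0\|_{\mathcal Y}<r_L\}$. Antilinear symmetry. $\mathcal C:\mathcal H\to\mathcal H$ is antilinear, isometric and involutive: for all $\phi,\psi\in\mathcal H$, $\lambda\in\mathbb C$, $\mathcal C(\lambda\phi+\psi)=\overline\lambda\,\mathcal C\phi+\mathcal C\psi$, $\langle\mathcal C\phi,\mathcal C\psi\rangle=\langle\psi,\phi\rangle$, $\mathcal C^2=I$. It is an antilinear symmetry of $A$ and $f$ if for all $\psi\in\operatorname{Dom}(A)$, $\mathcal C\psi\in\operatorname{Dom}(A)$ and $A\mathcal C\psi=\mathcal CA\psi$; and for all $\psi\in\mathcal Y$, $\mathcal C\psi\in\mathcal Y$ and $\mathcal Cf(\psi)=f(\mathcal C\psi)$. The nonlinear eigenpair. Let $P_0=\langle\cdot,\psi_0^*\rangle\psi_0$ (the spectral projection of $A$ for $\mu_0$), $Q_0=I-P_0$,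 $\nu=-\langle f(\psi_0),\psi_0^*\rangle$, and let $\phi$ be the unique solution in $Q_0\operatorname{Dom}(A)$ of $(A-\mu_0)\phi=\nu\psi_0+f(\psi_0)$. Let $C_{\mu_0}>0$ be a constant with $\|(Q_0(A-\mu_0)Q_0)^{-1}\eta\|_n\le C_{\mu_0}\|\eta\|_{n-1}$ for all $\eta\in Q_0\operatorname{Dom}(A^{n-1})$ (inverse taken in $Q_0\mathcal H$), and fix constants $r_1>k_1L\|P_0\|\|\phi\|_{\mathcal Y}$ and $r_2>k_2C_{\mu_0}(|\nu|+\|Q_0\|L)\|\phi\|_{\mathcal Y}$, $r_1,r_2>0$. For real $\varepsilon\neq0$ with $|\varepsilon|$ sufficiently small, the system $$0=\varepsilon\sigma+\langle f(\psi)-f(\psi_0),\psi_0^*\rangle,\qquad Q_0(A-\mu_0)Q_0\chi=\varepsilon[(\nu+\varepsilon\sigma)(\chi+\varepsilon\phi)+Q_0(f(\psi)-f(\psi_0))],$$ with $\psi=\psi_0+\varepsilon\phi+\chi$, has a unique solution $(\sigma,\chi)$, $\sigma\in\mathbb C$, $\chi\in Q_0\operatorname{Dom}(A)\cap\mathcal Y$, satisfying $|\sigma|\le r_1$, $\|\chi\|_{\mathcal Y}\le r_2\varepsilon^2$. The nonlinear eigenpair is $\mu(\varepsilon)=\mu_0+\varepsilon\nu+\varepsilon^2\sigma$, $\psi(\varepsilon)=\psi_0+\varepsilon\phi+\chi$ for this $(\sigma,\chi)$, and $(\mu(0),\psi(0))=(\mu_0,\psi_0)$; it solves $(A-\mu)\psi-\varepsilon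 f(\psi)=0$, $\langle\psi,\psi_0^*\rangle=1$. *)

theory Defs
  imports "HOL-Complex_Analysis.Complex_Analysis"
begin

section \<open>Complex Hilbert spaces\<close>

text \<open>The inner product is linear in the first argument. A Hilbert space is a whole type; its
  real Banach space structure (and hence its topology) comes from the class \<^class>\<open>banach\<close>, and
  the norm is the one induced by the inner product.\<close>

class complex_hilbert = banach +
  fixes scaleC :: "complex \<Rightarrow> 'a \<Rightarrow> 'a" (infixr "*\<^sub>C" 75)
    and cinner :: "'a \<Rightarrow> 'a \<Rightarrow> complex"
  assumes scaleC_add_right: "a *\<^sub>C (x + y) = a *\<^sub>C x + a *\<^sub>C y"
    and scaleC_add_left: "(a + b) *\<^sub>C x = a *\<^sub>C x + b *\<^sub>C x"
    and scaleC_scaleC: "a *\<^sub>C b *\<^sub>C x = (a * b) *\<^sub>C x"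
    and scaleC_one: "1 *\<^sub>C x = x"
    and scaleC_of_real: "complex_of_real r *\<^sub>C x = r *\<^sub>R x"
    and cinner_add_left: "cinner (x + y) z = cinner x z + cinner y z"
    and cinner_scaleC_left: "cinner (a *\<^sub>C x) y = a * cinner x y"
    and cinner_commute: "cinner y x = cnj (cinner x y)"
    and cinner_self: "cinner x x = complex_of_real ((norm x)\<^sup>2)"

interpretation complex_space: vector_space "scaleC :: complex \<Rightarrow> 'a \<Rightarrow> 'a::complex_hilbert"
  by unfold_locales (simp_all add: scaleC_add_right scaleC_add_left scaleC_scaleC scaleC_one)

section \<open>Unbounded operators\<close>

text \<open>An operator is given by its domain \<open>D\<close> and a total function \<open>A\<close> of which only the values on
  \<open>D\<close> are meaningful.\<close>

definition linear_operator :: "'h::complex_hilbert set \<Rightarrow> ('h \<Rightarrow> 'h) \<Rightarrow> bool" where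
  "linear_operator D A \<longleftrightarrow> complex_space.subspace D \<and>
     (\<forall>x\<in>D. \<forall>y\<in>D. A (x + y) = A x + A y) \<and> (\<forall>c. \<forall>x\<in>D. A (c *\<^sub>C x) = c *\<^sub>C A x)"

definition densely_defined :: "'h::complex_hilbert set \<Rightarrow> bool" where
  "densely_defined D \<longleftrightarrow> closure D = UNIV"

definition closed_operator :: "'h::complex_hilbert set \<Rightarrow> ('h \<Rightarrow> 'h) \<Rightarrow> bool" where
  "closed_operator D A \<longleftrightarrow> closed ((\<lambda>x. (x, A x)) ` D)"

definition resolvent :: "'h::complex_hilbert set \<Rightarrow> ('h \<Rightarrow> 'h) \<Rightarrow> complex \<Rightarrow> 'h \<Rightarrow> 'h" where
  "resolvent D A z = the_inv_into D (\<lambda>x. A x - z *\<^sub>C x)"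

definition resolvent_set :: "'h::complex_hilbert set \<Rightarrow> ('h \<Rightarrow> 'h) \<Rightarrow> complex set" where
  "resolvent_set D A =
     {z. bij_betw (\<lambda>x. A x - z *\<^sub>C x) D UNIV \<and> bounded_linear (resolvent D A z)}"

definition spectrum :: "'h::complex_hilbert set \<Rightarrow> ('h \<Rightarrow> 'h) \<Rightarrow> complex set" where
  "spectrum D A = - resolvent_set D A"

definition eigenvalue :: "'h::complex_hilbert set \<Rightarrow> ('h \<Rightarrow> 'h) \<Rightarrow> complex \<Rightarrow> bool" where
  "eigenvalue D A \<mu> \<longleftrightarrow> (\<exists>x\<in>D. x \<noteq> 0 \<and> A x = \<mu> *\<^sub>C x)"

text \<open>The Riesz projection \<open>- 1/(2\<pi>\<i>) \<ointegral> (A - z)\<^sup>-\<^sup>1 dz\<close> over the positively oriented circle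
  of radius \<open>\<rho>\<close> around \<open>\<mu>\<close>, applied to \<open>x\<close>. The library's contour integral is restricted to
  complex-valued integrands, so its definition is written out here for values in \<open>'h\<close>.\<close>

definition riesz_projection ::
    "'h::complex_hilbert set \<Rightarrow> ('h \<Rightarrow> 'h) \<Rightarrow> complex \<Rightarrow> real \<Rightarrow> 'h \<Rightarrow> 'h" where
  "riesz_projection D A \<mu> \<rho> x = (- 1 / (2 * of_real pi * \<i>)) *\<^sub>C
     integral {0..1} (\<lambda>t. vector_derivative (circlepath \<mu> \<rho>) (at t within {0..1}) *\<^sub>C
                           resolvent D A (circlepath \<mu> \<rho> t) x)"

text \<open>The algebraic multiplicity of an isolated eigenvalue is the dimension of the range of its
  Riesz projection, which does not depend on the circle as long as the closed disc meets the
  spectrum only in \<open>\<mu>\<close>. Note that \<open>dim = 1\<close> excludes an infinite-dimensional range, for which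
  \<open>dim\<close> is 0.\<close>

definition simple_isolated_eigenvalue ::
    "'h::complex_hilbert set \<Rightarrow> ('h \<Rightarrow> 'h) \<Rightarrow> complex \<Rightarrow> bool" where
  "simple_isolated_eigenvalue D A \<mu> \<longleftrightarrow> eigenvalue D A \<mu> \<and> \<mu> isolated_in spectrum D A \<and>
     (\<exists>\<rho>>0. cball \<mu> \<rho> \<inter> spectrum D A = {\<mu>} \<and>
        complex_space.dim (range (riesz_projection D A \<mu> \<rho>)) = 1)"

definition adjoint_dom :: "'h::complex_hilbert set \<Rightarrow> ('h \<Rightarrow> 'h) \<Rightarrow> 'h set" where
  "adjoint_dom D A = {y. \<exists>z. \<forall>x\<in>D. cinner (A x) y = cinner x z}"

definition adjoint_op :: "'h::complex_hilbert set \<Rightarrow> ('h \<Rightarrow> 'h) \<Rightarrow> 'h \<Rightarrow> 'h" where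
  "adjoint_op D A y = (THE z. \<forall>x\<in>D. cinner (A x) y = cinner x z)"

text \<open>\<open>dom_pow D A m\<close> is the domain of \<open>A\<^sup>m\<close>, and \<open>graph_norm A m\<close> is the norm
  \<open>\<parallel>\<cdot>\<parallel>\<^sub>m\<close>, meaningful on it.\<close>

fun dom_pow :: "'h::complex_hilbert set \<Rightarrow> ('h \<Rightarrow> 'h) \<Rightarrow> nat \<Rightarrow> 'h set" where
  "dom_pow D A 0 = UNIV"
| "dom_pow D A (Suc m) = {x \<in> D. A x \<in> dom_pow D A m}"

definition graph_norm :: "('h::complex_hilbert \<Rightarrow> 'h) \<Rightarrow> nat \<Rightarrow> 'h \<Rightarrow> real" where
  "graph_norm A m x = (\<Sum>k\<le>m. norm ((A ^^ k) x))"

text \<open>A linear subspace \<open>Y\<close> that is a Banach space under its own norm \<open>N\<close>.\<close>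

definition banach_subspace :: "'h::complex_hilbert set \<Rightarrow> ('h \<Rightarrow> real) \<Rightarrow> bool" where
  "banach_subspace Y N \<longleftrightarrow> complex_space.subspace Y \<and>
     (\<forall>x\<in>Y. 0 \<le> N x \<and> (N x = 0 \<longleftrightarrow> x = 0)) \<and>
     (\<forall>c. \<forall>x\<in>Y. N (c *\<^sub>C x) = cmod c * N x) \<and>
     (\<forall>x\<in>Y. \<forall>y\<in>Y. N (x + y) \<le> N x + N y) \<and>
     (\<forall>X. range X \<subseteq> Y \<and> (\<forall>e>0. \<exists>M::nat. \<forall>i\<ge>M. \<forall>j\<ge>M. N (X i - X j) < e) \<longrightarrow>
        (\<exists>x\<in>Y. (\<lambda>i. N (X i - x)) \<longlonglongrightarrow> 0))"

section \<open>Standing assumptions\<close>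

locale basic_assumption =
  fixes D :: "'h::complex_hilbert set" and A :: "'h \<Rightarrow> 'h" and f :: "'h \<Rightarrow> 'h"
    and Y :: "'h set" and normY :: "'h \<Rightarrow> real" and n :: nat
    and k1 k2 :: real and \<mu>0 :: complex and \<psi>0 \<psi>0s :: 'h and rL L :: real
  assumes A_linear: "linear_operator D A"
    and A_dense: "densely_defined D"
    and A_closed: "closed_operator D A"
    and A_resolvent: "resolvent_set D A \<noteq> {}"
    and Y_banach: "banach_subspace Y normY"
    and n_ge_1: "1 \<le> n"
    and Y_between: "dom_pow D A n \<subseteq> Y" "Y \<subseteq> dom_pow D A (n - 1)"
    and k_pos: "0 < k1" "0 < k2"
    and Y_norm: "\<And>x. x \<in> dom_pow D A n \<Longrightarrow>
       graph_norm A (n - 1) x \<le> k1 * normY x \<and> k1 * normY x \<le> k2 * graph_norm A n x"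
    and \<mu>0_simple: "simple_isolated_eigenvalue D A \<mu>0"
    and \<psi>0_eigen: "\<psi>0 \<in> D" "A \<psi>0 = \<mu>0 *\<^sub>C \<psi>0"
    and \<psi>0s_eigen: "\<psi>0s \<in> adjoint_dom D A" "adjoint_op D A \<psi>0s = cnj \<mu>0 *\<^sub>C \<psi>0s"
    and normalized: "norm \<psi>0 = 1" "cinner \<psi>0 \<psi>0s = 1"
    and f_maps: "f ` Y \<subseteq> dom_pow D A (n - 1)"
    and L_pos: "0 < rL" "0 < L"
    and f_lipschitz: "\<And>x y. \<lbrakk>x \<in> Y; y \<in> Y; normY (x - \<psi>0) < rL; normY (y - \<psi>0) < rL\<rbrakk> \<Longrightarrow>
       graph_norm A (n - 1) (f x - f y) \<le> k1 * L * normY (x - y)"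

definition antilinear_isometric_involution :: "('h::complex_hilbert \<Rightarrow> 'h) \<Rightarrow> bool" where
  "antilinear_isometric_involution \<C> \<longleftrightarrow>
     (\<forall>x y c. \<C> (c *\<^sub>C x + y) = cnj c *\<^sub>C \<C> x + \<C> y) \<and>
     (\<forall>x y. cinner (\<C> x) (\<C> y) = cinner y x) \<and> (\<forall>x. \<C> (\<C> x) = x)"

definition antilinear_symmetry :: "'h::complex_hilbert set \<Rightarrow> ('h \<Rightarrow> 'h) \<Rightarrow> 'h set \<Rightarrow> ('h \<Rightarrow> 'h) \<Rightarrow>
    ('h \<Rightarrow> 'h) \<Rightarrow> bool" where
  "antilinear_symmetry D A Y f \<C> \<longleftrightarrow> antilinear_isometric_involution \<C> \<and>
     (\<forall>x\<in>D. \<C> x \<in> D \<and> A (\<C> x) = \<C> (A x)) \<and>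
     (\<forall>x\<in>Y. \<C> x \<in> Y \<and> \<C> (f x) = f (\<C> x))"

section \<open>The nonlinear eigenpair\<close>

definition proj_P :: "'h::complex_hilbert \<Rightarrow> 'h \<Rightarrow> 'h \<Rightarrow> 'h" where
  "proj_P \<psi>0 \<psi>0s x = cinner x \<psi>0s *\<^sub>C \<psi>0"

definition proj_Q :: "'h::complex_hilbert \<Rightarrow> 'h \<Rightarrow> 'h \<Rightarrow> 'h" where
  "proj_Q \<psi>0 \<psi>0s x = x - proj_P \<psi>0 \<psi>0s x"

definition reduced_op :: "('h::complex_hilbert \<Rightarrow> 'h) \<Rightarrow> complex \<Rightarrow> 'h \<Rightarrow> 'h \<Rightarrow> 'h \<Rightarrow> 'h" where
  "reduced_op A \<mu>0 \<psi>0 \<psi>0s x =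
     proj_Q \<psi>0 \<psi>0s (A (proj_Q \<psi>0 \<psi>0s x) - \<mu>0 *\<^sub>C proj_Q \<psi>0 \<psi>0s x)"

text \<open>Inverse of \<open>Q\<^sub>0 (A - \<mu>\<^sub>0) Q\<^sub>0\<close> as an operator in \<open>Q\<^sub>0 H\<close>, i.e. with domain \<open>Q\<^sub>0 Dom(A)\<close>.\<close>

definition reduced_inverse ::
    "'h::complex_hilbert set \<Rightarrow> ('h \<Rightarrow> 'h) \<Rightarrow> complex \<Rightarrow> 'h \<Rightarrow> 'h \<Rightarrow> 'h \<Rightarrow> 'h" where
  "reduced_inverse D A \<mu>0 \<psi>0 \<psi>0s =
     the_inv_into (proj_Q \<psi>0 \<psi>0s ` D) (reduced_op A \<mu>0 \<psi>0 \<psi>0s)"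

definition nu :: "('h::complex_hilbert \<Rightarrow> 'h) \<Rightarrow> 'h \<Rightarrow> 'h \<Rightarrow> complex" where
  "nu f \<psi>0 \<psi>0s = - cinner (f \<psi>0) \<psi>0s"

definition phi :: "'h::complex_hilbert set \<Rightarrow> ('h \<Rightarrow> 'h) \<Rightarrow> ('h \<Rightarrow> 'h) \<Rightarrow> complex \<Rightarrow>
    'h \<Rightarrow> 'h \<Rightarrow> 'h" where
  "phi D A f \<mu>0 \<psi>0 \<psi>0s = (THE \<phi>. \<phi> \<in> proj_Q \<psi>0 \<psi>0s ` D \<and>
     A \<phi> - \<mu>0 *\<^sub>C \<phi> = nu f \<psi>0 \<psi>0s *\<^sub>C \<psi>0 + f \<psi>0)"

definition psi_of :: "'h::complex_hilbert set \<Rightarrow> ('h \<Rightarrow> 'h) \<Rightarrow> ('h \<Rightarrow> 'h) \<Rightarrow> complex \<Rightarrow>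
    'h \<Rightarrow> 'h \<Rightarrow> real \<Rightarrow> 'h \<Rightarrow> 'h" where
  "psi_of D A f \<mu>0 \<psi>0 \<psi>0s \<epsilon> \<xi> =
     \<psi>0 + complex_of_real \<epsilon> *\<^sub>C phi D A f \<mu>0 \<psi>0 \<psi>0s + \<xi>"

text \<open>\<open>(\<sigma>, \<xi>)\<close> solves the reduced system and lies in the region in which uniqueness holds
  (the letter \<open>\<xi>\<close> is used for the unknown \<open>chi\<close>, whose symbol is library syntax for vectors).\<close>

definition corrector :: "'h::complex_hilbert set \<Rightarrow> ('h \<Rightarrow> 'h) \<Rightarrow> ('h \<Rightarrow> 'h) \<Rightarrow> 'h set \<Rightarrow>
    ('h \<Rightarrow> real) \<Rightarrow> complex \<Rightarrow> 'h \<Rightarrow> 'h \<Rightarrow> real \<Rightarrow> real \<Rightarrow> real \<Rightarrow> complex \<times> 'h \<Rightarrow> bool" where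
  "corrector D A f Y normY \<mu>0 \<psi>0 \<psi>0s r1 r2 \<epsilon> = (\<lambda>(\<sigma>, \<xi>).
     (let \<nu> = nu f \<psi>0 \<psi>0s; \<phi> = phi D A f \<mu>0 \<psi>0 \<psi>0s; \<psi> = psi_of D A f \<mu>0 \<psi>0 \<psi>0s \<epsilon> \<xi>;
          e = complex_of_real \<epsilon>
      in \<xi> \<in> proj_Q \<psi>0 \<psi>0s ` D \<inter> Y \<and> cmod \<sigma> \<le> r1 \<and> normY \<xi> \<le> r2 * \<epsilon>\<^sup>2 \<and>
         0 = e * \<sigma> + cinner (f \<psi> - f \<psi>0) \<psi>0s \<and>
         reduced_op A \<mu>0 \<psi>0 \<psi>0s \<xi> =
           e *\<^sub>C ((\<nu> + e * \<sigma>) *\<^sub>C (\<xi> + e *\<^sub>C \<phi>) + proj_Q \<psi>0 \<psi>0s (f \<psi> - f \<psi>0))))"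

definition nonlinear_eigenpair :: "'h::complex_hilbert set \<Rightarrow> ('h \<Rightarrow> 'h) \<Rightarrow> ('h \<Rightarrow> 'h) \<Rightarrow> 'h set \<Rightarrow>
    ('h \<Rightarrow> real) \<Rightarrow> complex \<Rightarrow> 'h \<Rightarrow> 'h \<Rightarrow> real \<Rightarrow> real \<Rightarrow> real \<Rightarrow> complex \<times> 'h" where
  "nonlinear_eigenpair D A f Y normY \<mu>0 \<psi>0 \<psi>0s r1 r2 \<epsilon> =
     (if \<epsilon> = 0 then (\<mu>0, \<psi>0)
      else let (\<sigma>, \<xi>) = (THE p. corrector D A f Y normY \<mu>0 \<psi>0 \<psi>0s r1 r2 \<epsilon> p);
               e = complex_of_real \<epsilon>
           in (\<mu>0 + e * nu f \<psi>0 \<psi>0s + e\<^sup>2 * \<sigma>, psi_of D A f \<mu>0 \<psi>0 \<psi>0s \<epsilon> \<xi>))"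

end

theory Submission
  imports Defs
begin

text \<open>Because the Riesz projection for \<open>\<mu>\<^sub>0\<close> has one-dimensional range, \<open>A - \<mu>\<^sub>0\<close> maps
  \<open>Q\<^sub>0 Dom(A)\<close> bijectively onto \<open>Q\<^sub>0 H\<close>. The first equation of the system expresses \<open>\<sigma>\<close> through
  \<open>\<xi>\<close>, and what remains is a fixed point equation for \<open>\<xi>\<close>, which for small \<open>\<epsilon>\<close> is a contraction in
  the graph norm of \<open>A\<^sup>n\<close> on the ball \<open>\<parallel>\<xi>\<parallel>\<^sub>Y \<le> r\<^sub>2 \<epsilon>\<^sup>2\<close>. Since \<open>\<C>\<close> commutes with
  all ingredients, \<open>\<C> \<xi>\<close> is again a fixed point, and uniqueness gives \<open>\<C> \<xi> = \<xi>\<close> and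
  \<open>\<sigma> \<in> \<real>\<close>.\<close>

section \<open>Hilbert space preliminaries\<close>

text \<open>The norm of \<open>Y\<close> is known only to lie between the graph norms of orders
  \<open>n - 1\<close> and \<open>n\<close>. The Lipschitz condition bounds increments of
  \<open>f\<close> in order \<open>n - 1\<close> by the norm of \<open>Y\<close>, inverting
  \<open>A - \<mu>0\<close> on the range of \<open>Q\<close> gains one order, and order
  \<open>n\<close> controls the norm of \<open>Y\<close> again; the estimates close around this
  loop. The ball must be one in the norm of \<open>Y\<close>, because uniqueness is claimed there,
  while the metric is a graph norm, complete because \<open>A\<close> is closed. The lower bounds on
  \<open>r1\<close> and \<open>r2\<close> come from the bounds on \<sigma> and on \<xi> divided by
  \<epsilon> squared. These keep no factor \<epsilon>, so smallness of \<epsilon> alone cannot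
  produce them: they have to hold strictly in the limit \<epsilon> = 0, and then persist
  nearby.\<close>

lemma cinner_zero_left [simp]: "cinner 0 (y::'h::complex_hilbert) = 0"
  using cinner_scaleC_left[of 0 0 y] by simp

lemma cinner_minus_left [simp]: "cinner (- x) (y::'h::complex_hilbert) = - cinner x y"
  using cinner_scaleC_left[of "-1" x y] by simp

lemma cinner_diff_left: "cinner (x - z) (y::'h::complex_hilbert) = cinner x y - cinner z y"
  using cinner_add_left[of x "- z" y] by simp

lemma cinner_zero_right [simp]: "cinner (y::'h::complex_hilbert) 0 = 0"
  by (subst cinner_commute) simp

lemma cinner_diff_right: "cinner y (x - (z::'h::complex_hilbert)) = cinner y x - cinner y z"
  by (subst (1 2 3) cinner_commute) (simp add: cinner_diff_left)

lemma cinner_scaleC_right: "cinner x (a *\<^sub>C (y::'h::complex_hilbert)) = cnj a * cinner x y"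
  by (subst (1 2) cinner_commute) (simp add: cinner_scaleC_left)

lemma norm_scaleC: "norm (a *\<^sub>C (x::'h::complex_hilbert)) = cmod a * norm x"
proof -
  have "complex_of_real ((norm (a *\<^sub>C x))\<^sup>2) = a * cnj a * cinner x x"
    by (simp only: cinner_self[symmetric] cinner_scaleC_left cinner_scaleC_right mult_ac)
  also have "\<dots> = complex_of_real ((cmod a * norm x)\<^sup>2)"
    by (simp only: cinner_self complex_norm_square[symmetric] power_mult_distrib of_real_mult)
  finally have "complex_of_real ((norm (a *\<^sub>C x))\<^sup>2) = complex_of_real ((cmod a * norm x)\<^sup>2)" .
  then have "(norm (a *\<^sub>C x))\<^sup>2 = (cmod a * norm x)\<^sup>2"
    using of_real_eq_iff by blast
  then show ?thesis by (simp add: power2_eq_iff_nonneg)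
qed

lemma cauchy_schwarz: "cmod (cinner x (y::'h::complex_hilbert)) \<le> norm x * norm y"
proof (cases "y = 0")
  case False
  define c where "c = cinner x y / complex_of_real ((norm y)\<^sup>2)"
  have ny: "complex_of_real ((norm y)\<^sup>2) \<noteq> 0" using False by simp
  have "complex_of_real ((norm (x - c *\<^sub>C y))\<^sup>2)
      = cinner x x - c * cinner y x - cnj c * cinner x y + cnj c * c * cinner y y"
    by (simp only: cinner_self[symmetric])
      (simp add: cinner_scaleC_left cinner_scaleC_right cinner_diff_left cinner_diff_right
        algebra_simps)
  also have "\<dots> = complex_of_real ((norm x)\<^sup>2) - c * cnj (cinner x y)"
  proof -
    have "c * cinner y y = cinner x y" using ny by (simp add: c_def cinner_self)
    then show ?thesis by (simp add: cinner_commute[of y x] cinner_self[of x] mult.assoc)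
  qed
  also have "\<dots> = complex_of_real ((norm x)\<^sup>2 - (cmod (cinner x y))\<^sup>2 / (norm y)\<^sup>2)"
    by (simp add: c_def complex_norm_square[symmetric])
  finally have "(norm (x - c *\<^sub>C y))\<^sup>2 = (norm x)\<^sup>2 - (cmod (cinner x y))\<^sup>2 / (norm y)\<^sup>2"
    using of_real_eq_iff by blast
  then have "(cmod (cinner x y))\<^sup>2 / (norm y)\<^sup>2 \<le> (norm x)\<^sup>2"
    by (metis diff_ge_0_iff_ge zero_le_power2)
  then have "(cmod (cinner x y))\<^sup>2 \<le> (norm x * norm y)\<^sup>2"
    using False by (simp add: divide_le_eq power_mult_distrib)
  then show ?thesis by (rule power2_le_imp_le) simp
qed simp

lemma scaleC_scaleR: "a *\<^sub>C (r *\<^sub>R (x::'h::complex_hilbert)) = r *\<^sub>R (a *\<^sub>C x)"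
  by (simp add: scaleC_of_real[symmetric] mult.commute)

lemma scaleR_scaleC: "(r *\<^sub>R a) *\<^sub>C (x::'h::complex_hilbert) = r *\<^sub>R (a *\<^sub>C x)"
  by (simp add: scaleC_of_real[symmetric] scaleR_conv_of_real)

lemma bounded_bilinear_scaleC: "bounded_bilinear (scaleC :: complex \<Rightarrow> 'h::complex_hilbert \<Rightarrow> 'h)"
  by unfold_locales
    (auto simp: scaleC_add_right scaleC_add_left scaleC_scaleR scaleR_scaleC norm_scaleC
      intro: exI[of _ 1])

lemma bounded_linear_cinner_left: "bounded_linear (\<lambda>x. cinner x (y::'h::complex_hilbert))"
proof (rule bounded_linear_intro[where K = "norm y"])
  show "cinner (r *\<^sub>R x) y = r *\<^sub>R cinner x y" for r x
    by (simp add: scaleC_of_real[symmetric] cinner_scaleC_left scaleR_conv_of_real)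
qed (simp_all add: cinner_add_left cauchy_schwarz)

lemma bounded_linear_proj_P: "bounded_linear (proj_P \<psi> (\<psi>s::'h::complex_hilbert))"
  unfolding proj_P_def
  by (rule bounded_linear_compose[OF bounded_bilinear.bounded_linear_left[OF bounded_bilinear_scaleC]
      bounded_linear_cinner_left])

lemma bounded_linear_proj_Q: "bounded_linear (proj_Q \<psi> (\<psi>s::'h::complex_hilbert))"
  unfolding proj_Q_def
  by (intro bounded_linear_sub bounded_linear_proj_P bounded_linear_ident)

text \<open>This is the uniqueness behind the \<open>THE\<close> in \<open>adjoint_op\<close>: a
  dense domain determines the representing vector.\<close>

lemma cinner_right_eqI:
  assumes "densely_defined D" "\<And>x. x \<in> D \<Longrightarrow> cinner x y = cinner x (z::'h::complex_hilbert)"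
  shows "y = z"
proof -
  have "closed {x. cinner x (y - z) = 0}"
    by (intro closed_Collect_eq continuous_intros linear_continuous_on bounded_linear_cinner_left)
  moreover have "D \<subseteq> {x. cinner x (y - z) = 0}"
    using assms(2) by (auto simp: cinner_diff_right)
  ultimately have "closure D \<subseteq> {x. cinner x (y - z) = 0}"
    by (rule closure_minimal[rotated])
  then have "cinner (y - z) (y - z) = 0" using assms(1) by (auto simp: densely_defined_def)
  then show ?thesis by (simp add: cinner_self)
qed

lemma adjoint_opI:
  assumes "densely_defined D" "y \<in> adjoint_dom D A" "x \<in> D"
  shows "cinner (A x) y = cinner x (adjoint_op D A y)"
proof -
  have "\<exists>!z. \<forall>x\<in>D. cinner (A x) y = cinner x z"
    using assms(1,2) by (auto simp: adjoint_dom_def intro: cinner_right_eqI)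
  from theI'[OF this] assms(3) show ?thesis by (simp add: adjoint_op_def)
qed

section \<open>Resolvent and Riesz projection\<close>

lemma resolvent_in: "z \<in> resolvent_set D A \<Longrightarrow> resolvent D A z x \<in> D"
  unfolding resolvent_def resolvent_set_def
  by (auto simp: bij_betw_def intro: the_inv_into_into)

lemma resolvent_right: "z \<in> resolvent_set D A \<Longrightarrow>
    A (resolvent D A z x) - z *\<^sub>C resolvent D A z x = x"
  unfolding resolvent_def resolvent_set_def
  using f_the_inv_into_f[of "\<lambda>x. A x - z *\<^sub>C x" D x] by (auto simp: bij_betw_def)

lemma resolvent_left: "z \<in> resolvent_set D A \<Longrightarrow> y \<in> D \<Longrightarrow>
    resolvent D A z (A y - z *\<^sub>C y) = y"
  unfolding resolvent_def resolvent_set_def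
  using the_inv_into_f_f[of "\<lambda>x. A x - z *\<^sub>C x" D y] by (auto simp: bij_betw_def)

lemma resolvent_bounded_linear: "z \<in> resolvent_set D A \<Longrightarrow> bounded_linear (resolvent D A z)"
  by (simp add: resolvent_set_def)

context
  fixes D :: "'h::complex_hilbert set" and A :: "'h \<Rightarrow> 'h"
  assumes lin: "linear_operator D A"
begin

lemma linear_operator_simps:
  "x \<in> D \<Longrightarrow> y \<in> D \<Longrightarrow> A (x + y) = A x + A y"
  "x \<in> D \<Longrightarrow> A (c *\<^sub>C x) = c *\<^sub>C A x"
  "x \<in> D \<Longrightarrow> y \<in> D \<Longrightarrow> A (x - y) = A x - A y"
  "x \<in> D \<Longrightarrow> y \<in> D \<Longrightarrow> x + y \<in> D" "x \<in> D \<Longrightarrow> y \<in> D \<Longrightarrow> x - y \<in> D"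
  "x \<in> D \<Longrightarrow> c *\<^sub>C x \<in> D" "0 \<in> D" "A 0 = 0"
proof -
  have D: "complex_space.subspace D"
    and add: "\<And>x y. x \<in> D \<Longrightarrow> y \<in> D \<Longrightarrow> A (x + y) = A x + A y"
    and sc: "\<And>c x. x \<in> D \<Longrightarrow> A (c *\<^sub>C x) = c *\<^sub>C A x"
    using lin by (auto simp: linear_operator_def)
  show "x \<in> D \<Longrightarrow> y \<in> D \<Longrightarrow> A (x + y) = A x + A y" "x \<in> D \<Longrightarrow> A (c *\<^sub>C x) = c *\<^sub>C A x"
    by (fact add, fact sc)
  show "x \<in> D \<Longrightarrow> y \<in> D \<Longrightarrow> A (x - y) = A x - A y"
    using add[of x "(-1) *\<^sub>C y"] sc[of y "-1"] complex_space.subspace_scale[OF D, of y "-1"] by simp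
  show "x \<in> D \<Longrightarrow> y \<in> D \<Longrightarrow> x + y \<in> D" "x \<in> D \<Longrightarrow> y \<in> D \<Longrightarrow> x - y \<in> D"
    "x \<in> D \<Longrightarrow> c *\<^sub>C x \<in> D" "0 \<in> D"
    by (simp_all add: D complex_space.subspace_add complex_space.subspace_diff
        complex_space.subspace_scale complex_space.subspace_0)
  show "A 0 = 0" using sc[of 0 0] by (simp add: D complex_space.subspace_0)
qed

lemma resolvent_scaleC:
  assumes "z \<in> resolvent_set D A"
  shows "resolvent D A z (c *\<^sub>C x) = c *\<^sub>C resolvent D A z x"
proof -
  let ?y = "resolvent D A z x"
  have y: "?y \<in> D" by (rule resolvent_in[OF assms])
  have "A (c *\<^sub>C ?y) - z *\<^sub>C c *\<^sub>C ?y = c *\<^sub>C (A ?y - z *\<^sub>C ?y)"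
    using y by (simp add: linear_operator_simps complex_space.scale_right_diff_distrib mult.commute)
  also have "\<dots> = c *\<^sub>C x" by (simp add: resolvent_right[OF assms])
  finally show ?thesis
    using resolvent_left[OF assms, of "c *\<^sub>C ?y"] y by (simp add: linear_operator_simps)
qed

text \<open>The resolvent at \<open>w\<close> stands outside the product on purpose: with
  \<open>w\<close> fixed, every other resolvent is expressed through one bounded operator.\<close>

lemma resolvent_identity:
  assumes z: "z \<in> resolvent_set D A" and w: "w \<in> resolvent_set D A"
  shows "resolvent D A z x - resolvent D A w x = (z - w) *\<^sub>C resolvent D A w (resolvent D A z x)"
proof -
  let ?y = "resolvent D A z x"
  have "A ?y - w *\<^sub>C ?y = x + (z - w) *\<^sub>C ?y"
    using resolvent_right[of z D A x] z
    by (simp add: complex_space.scale_left_diff_distrib algebra_simps)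
  then have "?y = resolvent D A w (x + (z - w) *\<^sub>C ?y)"
    using resolvent_left[of w D A ?y] w resolvent_in[of z D A x] z by simp
  also have "\<dots> = resolvent D A w x + (z - w) *\<^sub>C resolvent D A w ?y"
    using resolvent_bounded_linear[OF w]
    by (simp add: linear_add bounded_linear.linear resolvent_scaleC[OF w])
  finally show ?thesis by (metis add_diff_cancel_left')
qed

text \<open>The resolvent identity bounds the difference by a multiple of the unknown
  \<open>resolvent D A z x\<close>. Once the factor is below 1/2 the unknown is absorbed and
  replaced by twice the value at \<open>w\<close>, which is uniform in \<open>z\<close>.\<close>

lemma continuous_on_resolvent: "continuous_on (resolvent_set D A) (\<lambda>z. resolvent D A z x)"
  unfolding continuous_on_def
proof
  fix w assume w: "w \<in> resolvent_set D A"
  let ?R = "resolvent D A"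
  let ?K = "onorm (?R w)"
  have bd: "norm (?R z x - ?R w x) \<le> cmod (z - w) * (?K * (2 * norm (?R w x)))"
    if z: "z \<in> resolvent_set D A" and small: "cmod (z - w) * ?K < 1/2" for z
  proof -
    have "norm (?R z x - ?R w x) = cmod (z - w) * norm (?R w (?R z x))"
      by (simp add: resolvent_identity[OF z w] norm_scaleC)
    also have le: "\<dots> \<le> cmod (z - w) * (?K * norm (?R z x))"
      by (intro mult_left_mono onorm resolvent_bounded_linear w) simp
    finally have 1: "norm (?R z x - ?R w x) \<le> cmod (z - w) * (?K * norm (?R z x))" .
    also have "\<dots> \<le> 1/2 * norm (?R z x)"
      using mult_right_mono[OF less_imp_le[OF small], of "norm (?R z x)"] by (simp add: mult.assoc)
    finally have "norm (?R z x) \<le> 2 * norm (?R w x)"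
      using norm_triangle_sub[of "?R z x" "?R w x"] by simp
    then have "cmod (z - w) * (?K * norm (?R z x)) \<le> cmod (z - w) * (?K * (2 * norm (?R w x)))"
      by (intro mult_left_mono onorm_pos_le resolvent_bounded_linear w) simp_all
    with 1 show ?thesis by simp
  qed
  let ?F = "at w within resolvent_set D A"
  have "((\<lambda>z. cmod (z - w) * ?K) \<longlongrightarrow> cmod (w - w) * ?K) ?F"
    by (intro tendsto_intros)
  then have ev: "\<forall>\<^sub>F z in ?F. cmod (z - w) * ?K < 1/2"
    by (rule order_tendstoD) simp
  have "((\<lambda>z. cmod (z - w) * (?K * (2 * norm (?R w x)))) \<longlongrightarrow>
      cmod (w - w) * (?K * (2 * norm (?R w x)))) ?F"
    by (intro tendsto_intros)
  then have lim: "((\<lambda>z. cmod (z - w) * (?K * (2 * norm (?R w x)))) \<longlongrightarrow> 0) ?F" by simp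
  have "((\<lambda>z. ?R z x - ?R w x) \<longlongrightarrow> 0) ?F"
    using ev by (intro Lim_null_comparison[OF _ lim])
      (auto simp: eventually_at_filter elim!: eventually_mono intro: bd)
  then show "((\<lambda>z. ?R z x) \<longlongrightarrow> ?R w x) ?F" by (rule Lim_null[THEN iffD2])
qed

lemma resolvent_eigenvector:
  assumes "z \<in> resolvent_set D A" "x \<in> D" "A x = \<mu> *\<^sub>C x"
  shows "(\<mu> - z) *\<^sub>C resolvent D A z x = x"
  using resolvent_left[of z D A x] assms
  by (metis complex_space.scale_left_diff_distrib resolvent_scaleC)

text \<open>Integration commutes with a closed operator; writing the operator through one resolvent
  reduces this to the case of a bounded operator.\<close>

lemma integral_resolvent:
  fixes a :: "real \<Rightarrow> complex" and z :: "real \<Rightarrow> complex"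
  assumes z: "\<And>t. t \<in> {0..1} \<Longrightarrow> z t \<in> resolvent_set D A"
    and ca: "continuous_on {0..1} a" and cz: "continuous_on {0..1} z"
  shows "integral {0..1} (\<lambda>t. a t *\<^sub>C resolvent D A (z t) x) \<in> D"
    and "A (integral {0..1} (\<lambda>t. a t *\<^sub>C resolvent D A (z t) x)) =
      integral {0..1} (\<lambda>t. a t *\<^sub>C x + (a t * z t) *\<^sub>C resolvent D A (z t) x)"
proof -
  let ?R = "resolvent D A"
  define w where "w = z 0"
  have w: "w \<in> resolvent_set D A" by (simp add: w_def z)
  note cs = bounded_bilinear.continuous_on[OF bounded_bilinear_scaleC]
  have cR: "continuous_on {0..1} (\<lambda>t. ?R (z t) x)"
    by (rule continuous_on_compose2[OF continuous_on_resolvent cz]) (auto intro: z)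
  \<comment> \<open>\<open>h\<close> is \<open>A - w\<close> applied to the integrand, computed from
    (A - w) R(z) = 1 + (z - w) R(z). Hence \<open>?R w\<close> takes \<open>h\<close> back to the
    integrand, and the bounded operator \<open>?R w\<close> can be pulled out of the
    integral.\<close>
  define h where "h t = a t *\<^sub>C x + (a t * (z t - w)) *\<^sub>C ?R (z t) x" for t
  have ch: "continuous_on {0..1} h"
    unfolding h_def by (intro continuous_intros cs cR ca cz)
  have Rh: "?R w (h t) = a t *\<^sub>C ?R (z t) x" if "t \<in> {0..1}" for t
  proof -
    have "?R w (h t) = a t *\<^sub>C (?R w x + (z t - w) *\<^sub>C ?R w (?R (z t) x))"
      using resolvent_bounded_linear[OF w]
      by (simp add: h_def linear_add bounded_linear.linear resolvent_scaleC[OF w] scaleC_add_right)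
    also have "\<dots> = a t *\<^sub>C ?R (z t) x"
      by (simp add: resolvent_identity[OF z[OF that] w, symmetric])
    finally show ?thesis .
  qed
  let ?I = "integral {0..1} (\<lambda>t. a t *\<^sub>C ?R (z t) x)"
  have I: "?I = ?R w (integral {0..1} h)"
  proof -
    have "?I = integral {0..1} (?R w \<circ> h)"
      by (rule integral_cong) (simp add: Rh)
    also have "\<dots> = ?R w (integral {0..1} h)"
      by (rule integral_linear[OF integrable_continuous_real[OF ch] resolvent_bounded_linear[OF w]])
    finally show ?thesis .
  qed
  show "?I \<in> D" unfolding I by (rule resolvent_in[OF w])
  have "A ?I = integral {0..1} h + w *\<^sub>C ?I"
    using resolvent_right[OF w, of "integral {0..1} h"] by (simp add: I diff_eq_eq)
  also have "w *\<^sub>C ?I = integral {0..1} (\<lambda>t. w *\<^sub>C a t *\<^sub>C ?R (z t) x)"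
    using integral_linear[of "\<lambda>t. a t *\<^sub>C ?R (z t) x" "{0..1}" "\<lambda>x. w *\<^sub>C x"]
    by (simp add: o_def bounded_bilinear.bounded_linear_right[OF bounded_bilinear_scaleC]
        integrable_continuous_real cs ca cR)
  also have "integral {0..1} h + \<dots> = integral {0..1} (\<lambda>t. h t + w *\<^sub>C a t *\<^sub>C ?R (z t) x)"
    by (rule integral_add[symmetric])
      (auto intro!: integrable_continuous_real ch cs ca cR continuous_intros)
  also have "(\<lambda>t. h t + w *\<^sub>C a t *\<^sub>C ?R (z t) x) = (\<lambda>t. a t *\<^sub>C x + (a t * z t) *\<^sub>C ?R (z t) x)"
    by (rule ext) (simp add: h_def ring_distribs complex_space.scale_left_diff_distrib mult.commute)
  finally show "A ?I = integral {0..1} (\<lambda>t. a t *\<^sub>C x + (a t * z t) *\<^sub>C ?R (z t) x)" .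
qed

end

context
  fixes D :: "'h::complex_hilbert set" and A :: "'h \<Rightarrow> 'h" and \<mu> :: complex and \<rho> :: real
  assumes lin: "linear_operator D A" and \<rho>: "0 < \<rho>" "cball \<mu> \<rho> \<inter> spectrum D A = {\<mu>}"
begin

lemma circlepath_in_resolvent_set: "circlepath \<mu> \<rho> t \<in> resolvent_set D A"
proof -
  have "dist \<mu> (circlepath \<mu> \<rho> t) = \<rho>"
    using \<rho>(1) by (simp add: circlepath dist_norm norm_mult)
  then have "circlepath \<mu> \<rho> t \<in> cball \<mu> \<rho>" "circlepath \<mu> \<rho> t \<noteq> \<mu>" using \<rho>(1) by auto
  then have "circlepath \<mu> \<rho> t \<notin> spectrum D A" using \<rho>(2) by blast
  then show ?thesis by (simp add: spectrum_def)
qed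

lemma continuous_on_resolvent_circlepath:
  "continuous_on {0..1} (circlepath \<mu> \<rho>)"
  "continuous_on {0..1} (\<lambda>t. resolvent D A (circlepath \<mu> \<rho> t) x)"
proof -
  show cz: "continuous_on {0..1} (circlepath \<mu> \<rho>)"
    unfolding circlepath by (intro continuous_intros)
  show "continuous_on {0..1} (\<lambda>t. resolvent D A (circlepath \<mu> \<rho> t) x)"
    by (rule continuous_on_compose2[OF continuous_on_resolvent[OF lin] cz])
      (use circlepath_in_resolvent_set in blast)
qed

text \<open>On the circle the path has derivative 2 pi i (z - \<mu>), so the prefactor cancels
  except for its sign.\<close>

lemma riesz_projection_eq:
  "riesz_projection D A \<mu> \<rho> x =
     - integral {0..1} (\<lambda>t. (circlepath \<mu> \<rho> t - \<mu>) *\<^sub>C resolvent D A (circlepath \<mu> \<rho> t) x)"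
proof -
  let ?c = "2 * of_real pi * \<i> :: complex"
  let ?h = "\<lambda>t. (circlepath \<mu> \<rho> t - \<mu>) *\<^sub>C resolvent D A (circlepath \<mu> \<rho> t) x"
  have h: "?h integrable_on {0..1}"
    by (intro integrable_continuous_real
        bounded_bilinear.continuous_on[OF bounded_bilinear_scaleC] continuous_on_diff
        continuous_on_const continuous_on_resolvent_circlepath)
  have "integral {0..1} (\<lambda>t. vector_derivative (circlepath \<mu> \<rho>) (at t within {0..1}) *\<^sub>C
      resolvent D A (circlepath \<mu> \<rho> t) x) = integral {0..1} (\<lambda>t. ?c *\<^sub>C ?h t)"
    by (rule integral_cong) (simp add: vector_derivative_circlepath01, simp add: circlepath mult_ac)
  also have "\<dots> = ?c *\<^sub>C integral {0..1} ?h"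
    using integral_linear[OF h bounded_bilinear.bounded_linear_right[OF bounded_bilinear_scaleC]]
    by (simp add: o_def)
  finally show ?thesis by (simp add: riesz_projection_def)
qed

lemma riesz_projection_eigenvector:
  assumes "x \<in> D" "A x = \<mu> *\<^sub>C x"
  shows "riesz_projection D A \<mu> \<rho> x = x"
proof -
  have "(circlepath \<mu> \<rho> t - \<mu>) *\<^sub>C resolvent D A (circlepath \<mu> \<rho> t) x = - x" for t
    using resolvent_eigenvector[OF lin circlepath_in_resolvent_set assms, of t]
    by (metis complex_space.scale_minus_left minus_diff_eq)
  then show ?thesis by (simp add: riesz_projection_eq)
qed

text \<open>On the circle \<open>(A - \<mu>) R(z) = 1 + (z - \<mu>) R(z)\<close>; integrated against
  \<open>dz / (2\<pi>\<i> (z - \<mu>))\<close> the right-hand side becomes the complement of the Riesz projection.\<close>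

lemma riesz_complement_in_range:
  "\<exists>y\<in>D. A y - \<mu> *\<^sub>C y = x - riesz_projection D A \<mu> \<rho> x"
proof -
  let ?z = "circlepath \<mu> \<rho>"
  let ?R = "\<lambda>t. resolvent D A (?z t) x"
  note cs = bounded_bilinear.continuous_on[OF bounded_bilinear_scaleC]
  note cz = continuous_on_resolvent_circlepath(1) and cR = continuous_on_resolvent_circlepath(2)
  \<comment> \<open>As a contour integral this is the constant term of the Laurent expansion of the
    resolvent at \<mu>, that is, the reduced resolvent applied to \<open>x\<close>.\<close>
  define y where "y = integral {0..1} ?R"
  have y: "y \<in> D" and Ay: "A y = integral {0..1} (\<lambda>t. x + ?z t *\<^sub>C ?R t)"
    using integral_resolvent[OF lin circlepath_in_resolvent_set continuous_on_const cz, of 1 x]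
    by (simp_all add: y_def)
  have "\<mu> *\<^sub>C y = integral {0..1} (\<lambda>t. \<mu> *\<^sub>C ?R t)"
    using integral_linear[OF integrable_continuous_real[OF cR]
        bounded_bilinear.bounded_linear_right[OF bounded_bilinear_scaleC], of \<mu>]
    by (simp add: o_def y_def)
  then have "A y - \<mu> *\<^sub>C y = integral {0..1} (\<lambda>t. (x + ?z t *\<^sub>C ?R t) - \<mu> *\<^sub>C ?R t)"
    unfolding Ay
    by (simp only:)
      (rule integral_diff[symmetric]; intro integrable_continuous_real continuous_on_add
        continuous_on_const cs cR cz)
  also have "\<dots> = integral {0..1} (\<lambda>t. x + (?z t - \<mu>) *\<^sub>C ?R t)"
    by (simp add: complex_space.scale_left_diff_distrib algebra_simps)
  also have "\<dots> = x - riesz_projection D A \<mu> \<rho> x"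
  proof -
    have "(\<lambda>t. (?z t - \<mu>) *\<^sub>C ?R t) integrable_on {0..1}"
      by (intro integrable_continuous_real continuous_on_diff continuous_on_const cs cR cz)
    then show ?thesis by (simp add: riesz_projection_eq integral_add integrable_const_ivl)
  qed
  finally show ?thesis using y by blast
qed

end

text \<open>The range of the Riesz projection is a line that contains \<open>v\<close>, so it is the
  line through \<open>v\<close>. The complementary part of any \<open>x\<close> lies in the range of
  \<open>A - \<mu>\<close>, and any solution of the eigenvalue equation is fixed by the projection,
  hence a multiple of \<open>v\<close>.\<close>

lemma simple_isolated_eigenvalue_decomposition:
  assumes lin: "linear_operator D A" and "simple_isolated_eigenvalue D A \<mu>"
    and v: "v \<in> D" "A v = \<mu> *\<^sub>C v" "v \<noteq> 0"
  shows "\<exists>c. \<exists>y\<in>D. x = c *\<^sub>C v + (A y - \<mu> *\<^sub>C y)"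
    and "x \<in> D \<Longrightarrow> A x = \<mu> *\<^sub>C x \<Longrightarrow> \<exists>c. x = c *\<^sub>C v"
proof -
  obtain \<rho> where \<rho>: "0 < \<rho>" "cball \<mu> \<rho> \<inter> spectrum D A = {\<mu>}"
    and dim: "complex_space.dim (range (riesz_projection D A \<mu> \<rho>)) = 1"
    using assms(2) by (auto simp: simple_isolated_eigenvalue_def)
  let ?P = "riesz_projection D A \<mu> \<rho>"
  obtain B where B: "range ?P \<subseteq> complex_space.span B" "card B = 1"
    using complex_space.basis_exists[of "range ?P"] dim by metis
  then obtain b where "B = {b}" by (auto simp: card_1_singleton_iff)
  with B have span: "\<exists>k. ?P y = k *\<^sub>C b" for y
    by (auto simp: complex_space.span_singleton)
  obtain k0 where k0: "v = k0 *\<^sub>C b"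
    using span[of v] riesz_projection_eigenvector[OF lin \<rho> v(1,2)] by auto
  have P: "\<exists>c. ?P y = c *\<^sub>C v" for y
  proof -
    obtain k where "?P y = k *\<^sub>C b" using span by blast
    moreover have "k0 \<noteq> 0" using k0 v(3) by auto
    ultimately have "?P y = (k / k0) *\<^sub>C v" by (simp add: k0)
    then show ?thesis ..
  qed
  then show "\<exists>c. x = c *\<^sub>C v" if "x \<in> D" "A x = \<mu> *\<^sub>C x"
    using riesz_projection_eigenvector[OF lin \<rho> that] by metis
  show "\<exists>c. \<exists>y\<in>D. x = c *\<^sub>C v + (A y - \<mu> *\<^sub>C y)"
    using P[of x] riesz_complement_in_range[OF lin \<rho>, of x] by (metis add.commute diff_add_cancel)
qed

section \<open>Graph norms\<close>

context
  fixes D :: "'h::complex_hilbert set" and A :: "'h \<Rightarrow> 'h"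
  assumes lin: "linear_operator D A"
begin

lemma dom_pow_iff: "x \<in> dom_pow D A m \<longleftrightarrow> (\<forall>k<m. (A ^^ k) x \<in> D)"
  by (induction m arbitrary: x) (simp_all add: All_less_Suc2 funpow_swap1)

lemma dom_pow_antimono: "k \<le> m \<Longrightarrow> dom_pow D A m \<subseteq> dom_pow D A k"
  by (auto simp: dom_pow_iff)

lemma funpow_linear:
  assumes "x \<in> dom_pow D A m" "k \<le> m"
  shows "y \<in> dom_pow D A m \<Longrightarrow> (A ^^ k) (x + y) = (A ^^ k) x + (A ^^ k) y"
    and "y \<in> dom_pow D A m \<Longrightarrow> (A ^^ k) (x - y) = (A ^^ k) x - (A ^^ k) y"
    and "(A ^^ k) (c *\<^sub>C x) = c *\<^sub>C (A ^^ k) x"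
proof -
  show "y \<in> dom_pow D A m \<Longrightarrow> (A ^^ k) (x + y) = (A ^^ k) x + (A ^^ k) y"
    using assms by (induction k) (simp_all add: dom_pow_iff linear_operator_simps[OF lin])
  show "y \<in> dom_pow D A m \<Longrightarrow> (A ^^ k) (x - y) = (A ^^ k) x - (A ^^ k) y"
    using assms by (induction k) (simp_all add: dom_pow_iff linear_operator_simps[OF lin])
  show "(A ^^ k) (c *\<^sub>C x) = c *\<^sub>C (A ^^ k) x"
    using assms by (induction k) (simp_all add: dom_pow_iff linear_operator_simps[OF lin])
qed

lemma funpow_eigenvector: "v \<in> D \<Longrightarrow> A v = \<mu> *\<^sub>C v \<Longrightarrow> (A ^^ k) v = \<mu> ^ k *\<^sub>C v"
  by (induction k) (simp_all add: linear_operator_simps[OF lin] mult.commute)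

lemma dom_pow_closed:
  assumes "x \<in> dom_pow D A m"
  shows "y \<in> dom_pow D A m \<Longrightarrow> x + y \<in> dom_pow D A m"
    and "y \<in> dom_pow D A m \<Longrightarrow> x - y \<in> dom_pow D A m"
    and "c *\<^sub>C x \<in> dom_pow D A m"
  using assms funpow_linear[OF assms]
  by (auto simp: dom_pow_iff linear_operator_simps[OF lin])

lemma zero_in_dom_pow: "0 \<in> dom_pow D A m"
  by (induction m) (simp_all add: linear_operator_simps[OF lin])

lemma eigenvector_in_dom_pow: "v \<in> D \<Longrightarrow> A v = \<mu> *\<^sub>C v \<Longrightarrow> v \<in> dom_pow D A m"
  by (auto simp: dom_pow_iff funpow_eigenvector[of v \<mu>] linear_operator_simps[OF lin])

text \<open>A regularity bootstrap: writing \<open>A x\<close> as the given vector plus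
  \<open>\<mu> *\<^sub>C x\<close>, each order known for \<open>x\<close> is known for
  \<open>A x\<close> too, which gives \<open>x\<close> one order more.\<close>

lemma dom_pow_SucI:
  assumes "x \<in> D" "A x - \<mu> *\<^sub>C x \<in> dom_pow D A m"
  shows "x \<in> dom_pow D A (Suc m)"
proof -
  have "k \<le> Suc m \<Longrightarrow> x \<in> dom_pow D A k" for k
  proof (induction k)
    case (Suc k)
    then have "x \<in> dom_pow D A k" "A x - \<mu> *\<^sub>C x \<in> dom_pow D A k"
      using assms(2) dom_pow_antimono[of k m] by auto
    then have "(A x - \<mu> *\<^sub>C x) + \<mu> *\<^sub>C x \<in> dom_pow D A k"
      using dom_pow_closed by blast
    then show ?case using assms(1) by simp
  qed simp
  then show ?thesis by blast
qed

lemma graph_norm_nonneg: "0 \<le> graph_norm A m x"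
  by (simp add: graph_norm_def sum_nonneg)

lemma norm_le_graph_norm: "k \<le> m \<Longrightarrow> norm ((A ^^ k) x) \<le> graph_norm A m x"
  unfolding graph_norm_def by (rule member_le_sum) simp_all

lemma graph_norm_triangle:
  "x \<in> dom_pow D A m \<Longrightarrow> y \<in> dom_pow D A m \<Longrightarrow>
    graph_norm A m (x + y) \<le> graph_norm A m x + graph_norm A m y"
  unfolding graph_norm_def sum.distrib[symmetric]
  by (rule sum_mono) (simp add: funpow_linear norm_triangle_ineq)

lemma graph_norm_scaleC:
  "x \<in> dom_pow D A m \<Longrightarrow> graph_norm A m (c *\<^sub>C x) = cmod c * graph_norm A m x"
  unfolding graph_norm_def sum_distrib_left
  by (rule sum.cong) (simp_all add: funpow_linear norm_scaleC)

lemma graph_norm_zero [simp]: "graph_norm A m 0 = 0"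
  using graph_norm_scaleC[OF zero_in_dom_pow, of m 0] by simp

lemma graph_norm_minus_commute:
  "x \<in> dom_pow D A m \<Longrightarrow> y \<in> dom_pow D A m \<Longrightarrow> graph_norm A m (x - y) = graph_norm A m (y - x)"
  using graph_norm_scaleC[of "y - x" m "-1"] by (simp add: dom_pow_closed)

text \<open>Every sequence of iterates converges in the Hilbert space. Closedness of
  \<open>A\<close> identifies the limit of the iterates of order \<open>Suc k\<close> with
  \<open>A\<close> applied to the limit of order \<open>k\<close>, so all limits are iterates of a
  single vector.\<close>

lemma graph_norm_complete:
  assumes cl: "closed_operator D A" and X: "\<And>i. X i \<in> dom_pow D A m"
    and Cauchy: "\<And>e. e > 0 \<Longrightarrow> \<exists>M::nat. \<forall>i\<ge>M. \<forall>j\<ge>M. graph_norm A m (X i - X j) < e"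
  obtains x where "x \<in> dom_pow D A m" "(\<lambda>i. graph_norm A m (X i - x)) \<longlonglongrightarrow> 0"
proof -
  have "\<exists>l. (\<lambda>i. (A ^^ k) (X i)) \<longlonglongrightarrow> l" if "k \<le> m" for k
  proof -
    have "Cauchy (\<lambda>i. (A ^^ k) (X i))"
    proof (rule CauchyI)
      fix e :: real assume "e > 0"
      then obtain M :: nat where M: "\<forall>i\<ge>M. \<forall>j\<ge>M. graph_norm A m (X i - X j) < e"
        using Cauchy by blast
      have "norm ((A ^^ k) (X i) - (A ^^ k) (X j)) < e" if "i \<ge> M" "j \<ge> M" for i j
      proof -
        have "graph_norm A m (X i - X j) < e" using M that by blast
        then show ?thesis
          using norm_le_graph_norm[OF \<open>k \<le> m\<close>, of "X i - X j"]
          by (simp add: funpow_linear(2)[OF X \<open>k \<le> m\<close> X])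
      qed
      then show "\<exists>M. \<forall>i\<ge>M. \<forall>j\<ge>M. norm ((A ^^ k) (X i) - (A ^^ k) (X j)) < e" by blast
    qed
    then show ?thesis by (simp add: Cauchy_convergent_iff convergent_def)
  qed
  then obtain l where l: "\<And>k. k \<le> m \<Longrightarrow> (\<lambda>i. (A ^^ k) (X i)) \<longlonglongrightarrow> l k" by metis
  have step: "l k \<in> D \<and> A (l k) = l (Suc k)" if "k < m" for k
  proof -
    have lim: "(\<lambda>i. ((A ^^ k) (X i), A ((A ^^ k) (X i)))) \<longlonglongrightarrow> (l k, l (Suc k))"
      using l[of k] l[of "Suc k"] that by (intro tendsto_Pair) simp_all
    have "(A ^^ k) (X i) \<in> D" for i
      using X[of i] that unfolding dom_pow_iff by blast
    then have "((A ^^ k) (X i), A ((A ^^ k) (X i))) \<in> (\<lambda>x. (x, A x)) ` D" for i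
      by (rule imageI)
    from closed_sequentially[OF cl[unfolded closed_operator_def] this lim]
    have "(l k, l (Suc k)) \<in> (\<lambda>x. (x, A x)) ` D" .
    then show ?thesis by auto
  qed
  have lk: "k \<le> m \<Longrightarrow> (A ^^ k) (l 0) = l k" for k
    by (induction k) (simp_all add: step)
  have l0: "l 0 \<in> dom_pow D A m" using lk step by (auto simp: dom_pow_iff)
  have "(\<lambda>i. \<Sum>k\<le>m. norm ((A ^^ k) (X i) - l k)) \<longlonglongrightarrow> (\<Sum>k\<le>m. 0)"
  proof (rule tendsto_sum)
    fix k assume "k \<in> {..m}"
    then show "(\<lambda>i. norm ((A ^^ k) (X i) - l k)) \<longlonglongrightarrow> 0"
      using l[of k] by (simp add: tendsto_norm_zero LIM_zero)
  qed
  moreover have "graph_norm A m (X i - l 0) = (\<Sum>k\<le>m. norm ((A ^^ k) (X i) - l k))" for i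
    unfolding graph_norm_def by (rule sum.cong) (simp_all add: funpow_linear[OF X] l0 lk)
  ultimately show ?thesis using that[OF l0] by simp
qed

end

section \<open>The reduced equation\<close>

context basic_assumption
begin

context
  notes One_nat_def [simp del]
begin

abbreviation "Q \<equiv> proj_Q \<psi>0 \<psi>0s"
abbreviation "P \<equiv> proj_P \<psi>0 \<psi>0s"
text \<open>By \<open>proj_Q_image\<close> this is the image of \<open>dom_pow D A m\<close> under
  \<open>Q\<close>; as a kernel it makes membership a single scalar equation.\<close>

abbreviation "dom_ker m \<equiv> {x \<in> dom_pow D A m. cinner x \<psi>0s = 0}"
abbreviation "R \<equiv> reduced_inverse D A \<mu>0 \<psi>0 \<psi>0s"
abbreviation "\<nu> \<equiv> nu f \<psi>0 \<psi>0s"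
abbreviation "\<phi> \<equiv> phi D A f \<mu>0 \<psi>0 \<psi>0s"

lemmas A_simps = linear_operator_simps[OF A_linear]

lemma cinner_range: "x \<in> D \<Longrightarrow> cinner (A x - \<mu>0 *\<^sub>C x) \<psi>0s = 0"
  using adjoint_opI[OF A_dense \<psi>0s_eigen(1), of x]
  by (simp add: \<psi>0s_eigen(2) cinner_diff_left cinner_scaleC_left cinner_scaleC_right)

lemma \<psi>0_nonzero: "\<psi>0 \<noteq> 0"
  using normalized(1) by auto

text \<open>Pairing with \<open>\<psi>0s\<close> annihilates the range of \<open>A - \<mu>0\<close>
  and is 1 at \<open>\<psi>0\<close>, which identifies the coefficient. In particular the kernel of
  the pairing is exactly that range.\<close>

lemma range_decomposition:
  obtains y where "y \<in> D" "x = cinner x \<psi>0s *\<^sub>C \<psi>0 + (A y - \<mu>0 *\<^sub>C y)"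
proof -
  obtain c y where y: "y \<in> D" and x: "x = c *\<^sub>C \<psi>0 + (A y - \<mu>0 *\<^sub>C y)"
    using simple_isolated_eigenvalue_decomposition(1)[OF A_linear \<mu>0_simple \<psi>0_eigen \<psi>0_nonzero]
    by blast
  have c: "cinner x \<psi>0s = c"
    by (subst x) (simp add: cinner_add_left cinner_scaleC_left normalized cinner_range[OF y])
  show ?thesis by (rule that[OF y]) (unfold c, rule x)
qed

lemma proj_Q_ker: "cinner x \<psi>0s = 0 \<Longrightarrow> Q x = x"
  by (simp add: proj_Q_def proj_P_def)

lemma cinner_proj_Q [simp]: "cinner (Q x) \<psi>0s = 0"
  by (simp add: proj_Q_def proj_P_def cinner_diff_left cinner_scaleC_left normalized)

lemma \<psi>0_in_dom_pow: "\<psi>0 \<in> dom_pow D A m"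
  by (rule eigenvector_in_dom_pow[OF A_linear \<psi>0_eigen])

lemma proj_Q_in_dom_pow: "x \<in> dom_pow D A m \<Longrightarrow> Q x \<in> dom_pow D A m"
  by (simp add: proj_Q_def proj_P_def dom_pow_closed[OF A_linear] \<psi>0_in_dom_pow)

lemma proj_Q_image: "Q ` dom_pow D A m = dom_ker m"
proof (intro equalityI subsetI)
  fix x assume "x \<in> dom_ker m"
  then show "x \<in> Q ` dom_pow D A m" by (intro image_eqI[of x Q x]) (auto simp: proj_Q_ker)
qed (auto simp: proj_Q_in_dom_pow)

lemma proj_Q_image_D: "Q ` D = {x \<in> D. cinner x \<psi>0s = 0}"
  using proj_Q_image[of "Suc 0"] by simp

lemma dom_ker_closed:
  "x \<in> dom_ker m \<Longrightarrow> y \<in> dom_ker m \<Longrightarrow> x + y \<in> dom_ker m"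
  "x \<in> dom_ker m \<Longrightarrow> y \<in> dom_ker m \<Longrightarrow> x - y \<in> dom_ker m"
  "x \<in> dom_ker m \<Longrightarrow> c *\<^sub>C x \<in> dom_ker m"
  "0 \<in> dom_ker m"
proof -
  show "x + y \<in> dom_ker m" if "x \<in> dom_ker m" "y \<in> dom_ker m"
    using that dom_pow_closed(1)[OF A_linear] by (simp add: cinner_add_left)
  show "x - y \<in> dom_ker m" if "x \<in> dom_ker m" "y \<in> dom_ker m"
    using that dom_pow_closed(2)[OF A_linear] by (simp add: cinner_diff_left)
  show "c *\<^sub>C x \<in> dom_ker m" if "x \<in> dom_ker m"
    using that dom_pow_closed(3)[OF A_linear] by (simp add: cinner_scaleC_left)
  show "0 \<in> dom_ker m" by (simp add: zero_in_dom_pow[OF A_linear])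
qed

lemma reduced_op_eq: "x \<in> D \<Longrightarrow> cinner x \<psi>0s = 0 \<Longrightarrow> reduced_op A \<mu>0 \<psi>0 \<psi>0s x = A x - \<mu>0 *\<^sub>C x"
  by (simp add: reduced_op_def proj_Q_ker cinner_range)

text \<open>Injective because the kernel of \<open>A - \<mu>0\<close> is the line of
  \<open>\<psi>0\<close>, on which the pairing with \<open>\<psi>0s\<close> vanishes only at 0.
  Surjective because passing from a preimage \<open>y\<close> to \<open>Q y\<close> subtracts a
  multiple of \<open>\<psi>0\<close>, which \<open>A - \<mu>0\<close> does not see.\<close>

lemma reduced_op_bij: "bij_betw (reduced_op A \<mu>0 \<psi>0 \<psi>0s) (Q ` D) {x. cinner x \<psi>0s = 0}"
proof (rule bij_betw_imageI)
  show "inj_on (reduced_op A \<mu>0 \<psi>0 \<psi>0s) (Q ` D)"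
  proof (rule inj_onI)
    fix x y assume x: "x \<in> Q ` D" and y: "y \<in> Q ` D"
      and eq: "reduced_op A \<mu>0 \<psi>0 \<psi>0s x = reduced_op A \<mu>0 \<psi>0 \<psi>0s y"
    have "x - y \<in> D" and 0: "cinner (x - y) \<psi>0s = 0"
      using x y by (auto simp: proj_Q_image_D A_simps cinner_diff_left)
    moreover have "A (x - y) = \<mu>0 *\<^sub>C (x - y)"
      using x y eq
      by (simp add: proj_Q_image_D A_simps reduced_op_eq complex_space.scale_right_diff_distrib)
        (simp add: algebra_simps)
    ultimately obtain c where c: "x - y = c *\<^sub>C \<psi>0"
      using simple_isolated_eigenvalue_decomposition(2)[OF A_linear \<mu>0_simple \<psi>0_eigen \<psi>0_nonzero]
      by blast
    with 0 have "c = 0" by (simp add: cinner_scaleC_left normalized)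
    with c show "x = y" by simp
  qed
  show "reduced_op A \<mu>0 \<psi>0 \<psi>0s ` Q ` D = {x. cinner x \<psi>0s = 0}"
  proof (intro equalityI subsetI)
    fix x assume "x \<in> {x. cinner x \<psi>0s = 0}"
    then obtain y where y: "y \<in> D" "x = A y - \<mu>0 *\<^sub>C y"
      using range_decomposition[of x] by auto
    have "Q y \<in> Q ` D" using y by blast
    moreover have "A (Q y) - \<mu>0 *\<^sub>C Q y = x"
      by (simp add: proj_Q_def proj_P_def A_simps y \<psi>0_eigen
          complex_space.scale_right_diff_distrib mult.commute)
    ultimately show "x \<in> reduced_op A \<mu>0 \<psi>0 \<psi>0s ` Q ` D"
      by (intro image_eqI[of x _ "Q y"]) (simp_all add: proj_Q_image_D reduced_op_eq)
  next
    fix x assume "x \<in> reduced_op A \<mu>0 \<psi>0 \<psi>0s ` Q ` D"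
    then obtain y where "y \<in> Q ` D" "x = reduced_op A \<mu>0 \<psi>0 \<psi>0s y" by blast
    then show "x \<in> {x. cinner x \<psi>0s = 0}"
      by (simp add: proj_Q_image_D reduced_op_eq cinner_range)
  qed
qed

lemma reduced_inverse_left:
  "x \<in> D \<Longrightarrow> cinner x \<psi>0s = 0 \<Longrightarrow> R (A x - \<mu>0 *\<^sub>C x) = x"
  using the_inv_into_f_f[OF bij_betw_imp_inj_on[OF reduced_op_bij], of x]
  by (simp add: reduced_inverse_def proj_Q_image_D reduced_op_eq)

lemma reduced_inverse:
  assumes "cinner \<eta> \<psi>0s = 0"
  shows "R \<eta> \<in> D" "cinner (R \<eta>) \<psi>0s = 0" "A (R \<eta>) - \<mu>0 *\<^sub>C R \<eta> = \<eta>"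
proof -
  have "\<eta> \<in> reduced_op A \<mu>0 \<psi>0 \<psi>0s ` Q ` D"
    using bij_betw_imp_surj_on[OF reduced_op_bij] assms by simp
  then obtain x where "x \<in> D" "cinner x \<psi>0s = 0" "\<eta> = A x - \<mu>0 *\<^sub>C x"
    by (auto simp: proj_Q_image_D reduced_op_eq)
  then show "R \<eta> \<in> D" "cinner (R \<eta>) \<psi>0s = 0" "A (R \<eta>) - \<mu>0 *\<^sub>C R \<eta> = \<eta>"
    by (simp_all add: reduced_inverse_left)
qed

lemma reduced_inverse_diff:
  assumes "cinner \<eta> \<psi>0s = 0" "cinner \<zeta> \<psi>0s = 0"
  shows "R (\<eta> - \<zeta>) = R \<eta> - R \<zeta>"
proof -
  have "A (R \<eta>) = \<eta> + \<mu>0 *\<^sub>C R \<eta>" "A (R \<zeta>) = \<zeta> + \<mu>0 *\<^sub>C R \<zeta>"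
    using reduced_inverse(3) assms by (metis diff_add_cancel)+
  then have "A (R \<eta> - R \<zeta>) - \<mu>0 *\<^sub>C (R \<eta> - R \<zeta>) = \<eta> - \<zeta>"
    by (simp add: A_simps reduced_inverse assms complex_space.scale_right_diff_distrib)
  then show ?thesis
    using reduced_inverse_left[of "R \<eta> - R \<zeta>"]
    by (simp add: A_simps reduced_inverse assms cinner_diff_left)
qed

text \<open>This gain of one order compensates for \<open>f\<close> having values only in the domain
  of the power \<open>n - 1\<close>.\<close>

lemma reduced_inverse_dom_ker:
  assumes "\<eta> \<in> dom_ker (n - 1)"
  shows "R \<eta> \<in> dom_ker n"
proof -
  have "R \<eta> \<in> dom_pow D A (Suc (n - 1))"
    using assms by (intro dom_pow_SucI[OF A_linear, of _ \<mu>0]) (simp_all add: reduced_inverse)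
  then show ?thesis using assms n_ge_1 by (simp add: reduced_inverse del: dom_pow.simps)
qed

section \<open>The norm of \<open>Y\<close> and Lipschitz estimates for the nonlinear right-hand
  side\<close>

lemma Y_subspace:
  "x \<in> Y \<Longrightarrow> y \<in> Y \<Longrightarrow> x + y \<in> Y" "x \<in> Y \<Longrightarrow> y \<in> Y \<Longrightarrow> x - y \<in> Y" "x \<in> Y \<Longrightarrow> c *\<^sub>C x \<in> Y"
proof -
  have "complex_space.subspace Y" using Y_banach unfolding banach_subspace_def by blast
  then show "x \<in> Y \<Longrightarrow> y \<in> Y \<Longrightarrow> x + y \<in> Y" "x \<in> Y \<Longrightarrow> y \<in> Y \<Longrightarrow> x - y \<in> Y" "x \<in> Y \<Longrightarrow> c *\<^sub>C x \<in> Y"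
    by (simp_all add: complex_space.subspace_add complex_space.subspace_diff
        complex_space.subspace_scale)
qed

lemma normY:
  "x \<in> Y \<Longrightarrow> 0 \<le> normY x" "x \<in> Y \<Longrightarrow> normY x = 0 \<longleftrightarrow> x = 0"
  "x \<in> Y \<Longrightarrow> normY (c *\<^sub>C x) = cmod c * normY x"
  "x \<in> Y \<Longrightarrow> y \<in> Y \<Longrightarrow> normY (x + y) \<le> normY x + normY y"
  using Y_banach unfolding banach_subspace_def by blast+

lemma dom_ker_in_Y: "x \<in> dom_ker n \<Longrightarrow> x \<in> Y"
  using Y_between(1) by blast

lemma \<psi>0_in_Y: "\<psi>0 \<in> Y"
  using Y_between(1) \<psi>0_in_dom_pow by blast

lemma graph_norm_le_normY: "x \<in> dom_ker n \<Longrightarrow> graph_norm A (n - 1) x \<le> k1 * normY x"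
  using Y_norm by blast

lemma normY_le_graph_norm: "x \<in> dom_ker n \<Longrightarrow> normY x \<le> k2 / k1 * graph_norm A n x"
  using Y_norm[of x] k_pos by (simp add: field_simps)

lemma f_in_dom_pow: "x \<in> Y \<Longrightarrow> f x \<in> dom_pow D A (n - 1)"
  using f_maps by blast

lemma phi_equation: "\<phi> \<in> dom_ker n" "A \<phi> - \<mu>0 *\<^sub>C \<phi> = \<nu> *\<^sub>C \<psi>0 + f \<psi>0"
proof -
  let ?b = "\<nu> *\<^sub>C \<psi>0 + f \<psi>0"
  have b: "?b \<in> dom_ker (n - 1)"
    by (simp add: dom_pow_closed[OF A_linear] \<psi>0_in_dom_pow f_in_dom_pow \<psi>0_in_Y
        cinner_add_left cinner_diff_left cinner_scaleC_left normalized nu_def)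
  then have b0: "cinner ?b \<psi>0s = 0" by blast
  have "\<phi> = R ?b"
    unfolding phi_def
  proof (rule the_equality)
    show "R ?b \<in> Q ` D \<and> A (R ?b) - \<mu>0 *\<^sub>C R ?b = ?b"
      using reduced_inverse[OF b0] by (simp add: proj_Q_image_D)
    show "x = R ?b" if "x \<in> Q ` D \<and> A x - \<mu>0 *\<^sub>C x = ?b" for x
      using that reduced_inverse_left[of x] by (auto simp: proj_Q_image_D)
  qed
  then show "\<phi> \<in> dom_ker n" "A \<phi> - \<mu>0 *\<^sub>C \<phi> = ?b"
    using reduced_inverse_dom_ker[OF b] reduced_inverse[OF b0] by simp_all
qed

text \<open>Since \<open>\<psi>0\<close> is a unit vector, \<open>P x\<close> has norm equal to the
  modulus of the pairing; this is how \<open>onorm P\<close> enters the condition on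
  \<open>r1\<close>.\<close>

lemma cinner_le_onorm: "cmod (cinner x \<psi>0s) \<le> onorm P * norm x"
  using onorm[OF bounded_linear_proj_P, of \<psi>0 \<psi>0s x]
  by (simp add: proj_P_def norm_scaleC normalized)

lemma onorm_P_nonneg: "0 \<le> onorm P" and onorm_Q_nonneg: "0 \<le> onorm Q"
  by (simp_all add: onorm_pos_le bounded_linear_proj_P bounded_linear_proj_Q)

text \<open>\<open>Q\<close> commutes with the powers of \<open>A\<close>, because
  \<open>\<psi>0\<close> is an eigenvector of \<open>A\<close> and the pairing with
  \<open>\<psi>0s\<close> turns \<open>A\<close> into multiplication by \<open>\<mu>0\<close>. One
  operator norm therefore serves all summands of the graph norm.\<close>

lemma graph_norm_proj_Q:
  assumes x: "x \<in> dom_pow D A m"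
  shows "graph_norm A m (Q x) \<le> onorm Q * graph_norm A m x"
  unfolding graph_norm_def sum_distrib_left
proof (rule sum_mono)
  fix k assume "k \<in> {..m}"
  then have k: "k \<le> m" by simp
  have c: "cinner ((A ^^ k) x) \<psi>0s = \<mu>0 ^ k * cinner x \<psi>0s"
    using k
  proof (induction k)
    case (Suc k)
    then have "(A ^^ k) x \<in> D" using x by (simp add: dom_pow_iff[OF A_linear])
    from cinner_range[OF this] Suc show ?case
      by (simp add: cinner_diff_left cinner_scaleC_left)
  qed simp
  have "(A ^^ k) (Q x) = Q ((A ^^ k) x)"
    using x k \<psi>0_in_dom_pow[of m]
    by (simp add: proj_Q_def proj_P_def funpow_linear[OF A_linear, of _ m] dom_pow_closed[OF A_linear]
        funpow_eigenvector[OF A_linear \<psi>0_eigen] c mult.commute)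
  then show "norm ((A ^^ k) (Q x)) \<le> onorm Q * norm ((A ^^ k) x)"
    using onorm[OF bounded_linear_proj_Q] by simp
qed

definition "increment u = f (\<psi>0 + u) - f \<psi>0"

text \<open>Right-hand side of the second equation of the system in the variable u = \<epsilon>
  \<phi> + \<xi>, with \<epsilon> \<sigma> eliminated by the first equation.\<close>

definition "rhs \<epsilon> u = complex_of_real \<epsilon> *\<^sub>C
  ((\<nu> - cinner (increment u) \<psi>0s) *\<^sub>C u + Q (increment u))"

lemma increment_in_dom_pow: "u \<in> Y \<Longrightarrow> increment u \<in> dom_pow D A (n - 1)"
  by (simp add: increment_def dom_pow_closed[OF A_linear] f_in_dom_pow Y_subspace \<psi>0_in_Y)

text \<open>Membership in \<open>Y\<close> has to suffice for \<open>u\<close>: a solution of the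
  system is not known beforehand to lie in the domain of the power \<open>n\<close>.\<close>

lemma rhs_in_dom_ker:
  assumes "u \<in> Y" "cinner u \<psi>0s = 0"
  shows "rhs \<epsilon> u \<in> dom_ker (n - 1)"
proof -
  have "u \<in> dom_ker (n - 1)" using assms Y_between(2) by blast
  moreover have "Q (increment u) \<in> dom_ker (n - 1)"
    using increment_in_dom_pow[OF assms(1)] proj_Q_in_dom_pow by simp
  ultimately show ?thesis unfolding rhs_def by (intro dom_ker_closed)
qed

lemma increment_lipschitz:
  assumes "u \<in> Y" "v \<in> Y" "normY u < rL" "normY v < rL"
  shows "graph_norm A (n - 1) (increment u - increment v) \<le> k1 * L * normY (u - v)"
  using f_lipschitz[of "\<psi>0 + u" "\<psi>0 + v"] assms
  by (simp add: increment_def Y_subspace \<psi>0_in_Y)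

lemma increment_bound:
  assumes "u \<in> Y" "normY u < rL"
  shows "graph_norm A (n - 1) (increment u) \<le> k1 * L * normY u"
proof -
  have "(0::'h) \<in> Y" using Y_subspace(2)[OF \<psi>0_in_Y \<psi>0_in_Y] by simp
  moreover from this have "normY 0 = 0" by (simp add: normY)
  ultimately show ?thesis
    using increment_lipschitz[of u 0] assms L_pos by (simp add: increment_def)
qed

lemma cinner_le_graph_norm: "cmod (cinner x \<psi>0s) \<le> onorm P * graph_norm A m x"
proof -
  have "norm x \<le> graph_norm A m x" using norm_le_graph_norm[OF A_linear, of 0 m x] by simp
  then show ?thesis
    using cinner_le_onorm[of x] mult_left_mono[OF _ onorm_P_nonneg, of "norm x" "graph_norm A m x"]
    by linarith
qed

text \<open>Lipschitz factor of \<open>rhs\<close> on vectors of \<open>Y\<close>-norm at most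
  \<open>s\<close>, without the factors \<bar>\<epsilon>\<bar> and \<open>k1\<close>. The product of
  the pairing with \<open>u\<close> contributes twice, whence the 2. At \<open>s = 0\<close> it is
  the factor that appears in the condition on \<open>r2\<close>.\<close>

definition "lip s = cmod \<nu> + onorm Q * L + 2 * onorm P * k1 * L * s"

lemma lip_nonneg: "0 \<le> s \<Longrightarrow> 0 \<le> lip s"
  using onorm_P_nonneg onorm_Q_nonneg L_pos k_pos by (simp add: lip_def)

lemma rhs_lipschitz:
  assumes u: "u \<in> dom_ker n" "normY u \<le> s" and v: "v \<in> dom_ker n" "normY v \<le> s" and s: "s < rL"
  shows "graph_norm A (n - 1) (rhs \<epsilon> u - rhs \<epsilon> v) \<le> \<bar>\<epsilon>\<bar> * k1 * lip s * normY (u - v)"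
proof -
  let ?G = "graph_norm A (n - 1)" and ?g = increment and ?e = "complex_of_real \<epsilon>"
  let ?w = "?g u - ?g v" and ?N = "normY (u - v)"
  have Y: "u \<in> Y" "v \<in> Y" by (rule dom_ker_in_Y[OF u(1)], rule dom_ker_in_Y[OF v(1)])
  have dom: "x \<in> dom_ker n \<Longrightarrow> x \<in> dom_pow D A (n - 1)" for x
    using dom_pow_antimono[OF A_linear, of "n - 1" n] by auto
  have uv: "u - v \<in> dom_ker n" by (rule dom_ker_closed(2)[OF u(1) v(1)])
  have N: "0 \<le> ?N" using Y by (simp add: normY Y_subspace)
  have s0: "0 \<le> s" using normY(1)[OF Y(1)] u(2) by linarith
  have w: "?w \<in> dom_pow D A (n - 1)"
    using Y by (simp add: increment_in_dom_pow dom_pow_closed[OF A_linear])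
  have Gw: "?G ?w \<le> k1 * L * ?N" using increment_lipschitz Y u(2) v(2) s by simp
  have cw: "cmod (cinner ?w \<psi>0s) \<le> onorm P * (k1 * L * ?N)"
    using cinner_le_graph_norm[of ?w "n - 1"] mult_left_mono[OF Gw onorm_P_nonneg] by linarith
  have "k1 * L * normY u \<le> k1 * L * s" using u(2) k_pos L_pos by (intro mult_left_mono) simp_all
  then have "?G (?g u) \<le> k1 * L * s" using increment_bound[OF Y(1)] u(2) s by linarith
  from mult_left_mono[OF this onorm_P_nonneg]
  have cu: "cmod (cinner (?g u) \<psi>0s) \<le> onorm P * (k1 * L * s)"
    using cinner_le_graph_norm[of "?g u" "n - 1"] by linarith
  \<comment> \<open>Product rule for differences: \<open>a\<close> is the full scalar factor at
    \<open>u\<close> and multiplies \<open>u - v\<close>, while \<open>b\<close> is the change of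
    that factor from \<open>v\<close> to \<open>u\<close> and multiplies \<open>v\<close>.\<close>
  define a where "a = \<nu> - cinner (?g u) \<psi>0s"
  define b where "b = - cinner ?w \<psi>0s"
  have a: "cmod a \<le> cmod \<nu> + onorm P * (k1 * L * s)"
    unfolding a_def using cu norm_triangle_ineq4[of \<nu> "cinner (?g u) \<psi>0s"] by linarith
  have b: "cmod b \<le> onorm P * (k1 * L * ?N)" using cw by (simp add: b_def)
  have "rhs \<epsilon> u - rhs \<epsilon> v = ?e *\<^sub>C (a *\<^sub>C (u - v) + b *\<^sub>C v + Q ?w)"
  proof -
    have "Q ?w = Q (?g u) - Q (?g v)"
      by (simp add: linear_diff bounded_linear.linear bounded_linear_proj_Q)
    then show ?thesis
      unfolding rhs_def a_def b_def
      by (simp add: complex_space.scale_right_diff_distrib complex_space.scale_left_diff_distrib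
          scaleC_add_right cinner_diff_left right_diff_distrib)
  qed
  also have "?G \<dots> = \<bar>\<epsilon>\<bar> * ?G (a *\<^sub>C (u - v) + b *\<^sub>C v + Q ?w)"
    using dom[OF uv] dom[OF v(1)] w
    by (simp add: graph_norm_scaleC[OF A_linear] dom_pow_closed[OF A_linear] proj_Q_in_dom_pow)
  also have "\<dots> \<le> \<bar>\<epsilon>\<bar> * (cmod a * ?G (u - v) + cmod b * ?G v + onorm Q * ?G ?w)"
  proof (rule mult_left_mono)
    have 1: "a *\<^sub>C (u - v) \<in> dom_pow D A (n - 1)" "b *\<^sub>C v \<in> dom_pow D A (n - 1)"
      "Q ?w \<in> dom_pow D A (n - 1)"
      using dom[OF uv] dom[OF v(1)] w by (simp_all add: dom_pow_closed[OF A_linear] proj_Q_in_dom_pow)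
    have "?G (a *\<^sub>C (u - v) + b *\<^sub>C v + Q ?w) \<le> ?G (a *\<^sub>C (u - v)) + ?G (b *\<^sub>C v) + ?G (Q ?w)"
      using graph_norm_triangle[OF A_linear 1(1,2)]
        graph_norm_triangle[OF A_linear dom_pow_closed(1)[OF A_linear 1(1,2)] 1(3)] by linarith
    then show "?G (a *\<^sub>C (u - v) + b *\<^sub>C v + Q ?w)
        \<le> cmod a * ?G (u - v) + cmod b * ?G v + onorm Q * ?G ?w"
      using graph_norm_proj_Q[OF w] dom[OF uv] dom[OF v(1)] by (simp add: graph_norm_scaleC[OF A_linear])
  qed simp
  also have "\<dots> \<le> \<bar>\<epsilon>\<bar> * ((cmod \<nu> + onorm P * (k1 * L * s)) * (k1 * ?N)
      + (onorm P * (k1 * L * ?N)) * (k1 * s) + onorm Q * (k1 * L * ?N))"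
  proof (intro mult_left_mono add_mono mult_mono a b Gw)
    show "?G (u - v) \<le> k1 * ?N" using graph_norm_le_normY[OF uv] .
    show "?G v \<le> k1 * s"
      using graph_norm_le_normY[OF v(1)] mult_left_mono[OF v(2), of k1] k_pos by linarith
  qed (use onorm_P_nonneg onorm_Q_nonneg N s0 k_pos L_pos graph_norm_nonneg[OF A_linear] in simp_all)
  also have "\<dots> = \<bar>\<epsilon>\<bar> * k1 * lip s * ?N" by (simp add: lip_def algebra_simps)
  finally show ?thesis .
qed

text \<open>Bounds the \<open>Y\<close>-norm of (\<epsilon> \<phi> + \<xi>) / \<epsilon> over the
  ball of radius r2 \<epsilon>^2 for \<xi>.\<close>

definition "amplitude r2 \<epsilon> = normY \<phi> + r2 * \<bar>\<epsilon>\<bar>"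

end

end

section \<open>Existence and uniqueness of the corrector\<close>

text \<open>The four smallness conditions keep \<psi> in the Lipschitz ball of \<open>f\<close>,
  make the ball for \<xi> invariant, make the map contract by 1/2, and bound \<sigma>. In the second
  a factor \<epsilon>^2 has been divided out and in the fourth a factor
  \<bar>\<epsilon>\<bar>.\<close>

locale small_parameter = basic_assumption +
  fixes C\<mu> r1 r2 \<epsilon> :: real
  assumes C\<mu>_pos: "0 < C\<mu>"
    and C\<mu>_bound: "\<And>\<eta>. \<eta> \<in> dom_ker (n - 1) \<Longrightarrow>
      graph_norm A n (R \<eta>) \<le> C\<mu> * graph_norm A (n - 1) \<eta>"
    and r2_pos: "0 < r2"
    and \<epsilon>_nonzero: "\<epsilon> \<noteq> 0"
    and small_lipschitz: "\<bar>\<epsilon>\<bar> * amplitude r2 \<epsilon> < rL"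
    and small_self_map: "k2 * C\<mu> * lip (\<bar>\<epsilon>\<bar> * amplitude r2 \<epsilon>) * amplitude r2 \<epsilon> \<le> r2"
    and small_contraction: "k2 * C\<mu> * \<bar>\<epsilon>\<bar> * lip (\<bar>\<epsilon>\<bar> * amplitude r2 \<epsilon>) \<le> 1 / 2"
    and small_sigma: "onorm P * k1 * L * amplitude r2 \<epsilon> \<le> r1"
begin

context
  notes One_nat_def [simp del]
begin

abbreviation "shift \<xi> \<equiv> complex_of_real \<epsilon> *\<^sub>C \<phi> + \<xi>"
abbreviation "B \<equiv> {\<xi> \<in> dom_ker n. normY \<xi> \<le> r2 * \<epsilon>\<^sup>2}"
abbreviation "s \<equiv> \<bar>\<epsilon>\<bar> * amplitude r2 \<epsilon>"
abbreviation "H \<equiv> graph_norm A n"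

definition "T \<xi> = R (rhs \<epsilon> (shift \<xi>))"

lemma amplitude_nonneg: "0 \<le> amplitude r2 \<epsilon>"
  using normY(1)[OF dom_ker_in_Y[OF phi_equation(1)]] r2_pos by (simp add: amplitude_def)

lemma shift_in_dom_ker: "\<xi> \<in> dom_ker n \<Longrightarrow> shift \<xi> \<in> dom_ker n"
  by (rule dom_ker_closed(1)[OF dom_ker_closed(3)[OF phi_equation(1)]])

lemma normY_shift:
  assumes "\<xi> \<in> B"
  shows "normY (shift \<xi>) \<le> s"
proof -
  have Y: "\<phi> \<in> Y" "\<xi> \<in> Y" using assms phi_equation dom_ker_in_Y by blast+
  have "normY (shift \<xi>) \<le> \<bar>\<epsilon>\<bar> * normY \<phi> + normY \<xi>"
    using normY(4)[OF Y_subspace(3)[OF Y(1)] Y(2), of "complex_of_real \<epsilon>"]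
    by (simp add: normY(3)[OF Y(1)])
  also have "\<dots> \<le> \<bar>\<epsilon>\<bar> * normY \<phi> + r2 * \<epsilon>\<^sup>2" using assms by simp
  also have "\<dots> = s" by (simp add: amplitude_def distrib_left power2_eq_square)
  finally show ?thesis .
qed

lemma rhs_shift_in_dom_ker: "\<xi> \<in> dom_ker n \<Longrightarrow> rhs \<epsilon> (shift \<xi>) \<in> dom_ker (n - 1)"
  using shift_in_dom_ker[of \<xi>] dom_ker_in_Y[of "shift \<xi>"] by (intro rhs_in_dom_ker) blast+

lemma T_in_dom_ker: "\<xi> \<in> dom_ker n \<Longrightarrow> T \<xi> \<in> dom_ker n"
  unfolding T_def by (intro reduced_inverse_dom_ker rhs_shift_in_dom_ker)

lemma T_lipschitz:
  assumes "\<xi> \<in> B" "\<zeta> \<in> B"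
  shows "H (T \<xi> - T \<zeta>) \<le> C\<mu> * (\<bar>\<epsilon>\<bar> * k1 * lip s * normY (\<xi> - \<zeta>))"
proof -
  have k: "\<xi> \<in> dom_ker n" "\<zeta> \<in> dom_ker n" using assms by blast+
  let ?u = "shift \<xi>" and ?v = "shift \<zeta>"
  have eq: "T \<xi> - T \<zeta> = R (rhs \<epsilon> ?u - rhs \<epsilon> ?v)"
    using rhs_shift_in_dom_ker[OF k(1)] rhs_shift_in_dom_ker[OF k(2)]
    by (simp add: T_def reduced_inverse_diff)
  have "H (T \<xi> - T \<zeta>) \<le> C\<mu> * graph_norm A (n - 1) (rhs \<epsilon> ?u - rhs \<epsilon> ?v)"
    unfolding eq by (intro C\<mu>_bound dom_ker_closed rhs_shift_in_dom_ker k)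
  also have "\<dots> \<le> C\<mu> * (\<bar>\<epsilon>\<bar> * k1 * lip s * normY (?u - ?v))"
    by (rule mult_left_mono[OF rhs_lipschitz[OF shift_in_dom_ker[OF k(1)] normY_shift[OF assms(1)]
        shift_in_dom_ker[OF k(2)] normY_shift[OF assms(2)] small_lipschitz] less_imp_le[OF C\<mu>_pos]])
  finally show ?thesis unfolding add_diff_cancel_left .
qed

lemma rhs_zero: "rhs \<epsilon> 0 = 0"
  by (simp add: rhs_def increment_def proj_Q_ker)

text \<open>Comparison with \<open>rhs \<epsilon> 0 = 0\<close> turns the Lipschitz estimate into a
  growth estimate. The factor \<open>k1 / k2\<close> is the one that
  \<open>normY_le_graph_norm\<close> undoes in \<open>in_B_I\<close>, so this is stronger than
  membership in \<open>B\<close>.\<close>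

lemma T_bound:
  assumes "\<xi> \<in> B"
  shows "H (T \<xi>) \<le> k1 / k2 * (r2 * \<epsilon>\<^sup>2)"
proof -
  have k: "\<xi> \<in> dom_ker n" using assms by blast
  let ?u = "shift \<xi>"
  have s0: "0 \<le> s" using amplitude_nonneg by simp
  have "normY 0 = 0" using normY(2)[OF dom_ker_in_Y[OF dom_ker_closed(4)]] by simp
  then have "graph_norm A (n - 1) (rhs \<epsilon> ?u - rhs \<epsilon> 0) \<le> \<bar>\<epsilon>\<bar> * k1 * lip s * normY (?u - 0)"
    using s0 by (intro rhs_lipschitz[OF shift_in_dom_ker[OF k] normY_shift[OF assms]
          dom_ker_closed(4) _ small_lipschitz]) simp
  also have "\<dots> \<le> \<bar>\<epsilon>\<bar> * k1 * lip s * s"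
    using normY_shift[OF assms] k_pos lip_nonneg[OF s0] by (intro mult_left_mono) simp_all
  finally have rhs: "graph_norm A (n - 1) (rhs \<epsilon> ?u) \<le> \<bar>\<epsilon>\<bar> * k1 * lip s * s"
    by (simp add: rhs_zero)
  have "H (T \<xi>) \<le> C\<mu> * graph_norm A (n - 1) (rhs \<epsilon> ?u)"
    unfolding T_def by (intro C\<mu>_bound rhs_shift_in_dom_ker k)
  also have "\<dots> \<le> C\<mu> * (\<bar>\<epsilon>\<bar> * k1 * lip s * s)"
    using rhs C\<mu>_pos by (intro mult_left_mono) simp_all
  \<comment> \<open>One factor \<bar>\<epsilon>\<bar> comes from \<open>rhs\<close> and one from
    \<open>s\<close>; together they give the square in the radius.\<close>
  also have "\<dots> = k1 / k2 * \<epsilon>\<^sup>2 * (k2 * C\<mu> * lip s * amplitude r2 \<epsilon>)"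
    using k_pos by (simp add: power2_eq_square abs_mult_self_eq mult_ac)
  also have "\<dots> \<le> k1 / k2 * \<epsilon>\<^sup>2 * r2"
    using small_self_map k_pos by (intro mult_left_mono) simp_all
  finally show ?thesis by (simp add: mult_ac)
qed

lemma in_B_I:
  assumes "\<xi> \<in> dom_ker n" "H \<xi> \<le> k1 / k2 * (r2 * \<epsilon>\<^sup>2)"
  shows "\<xi> \<in> B"
proof -
  have "normY \<xi> \<le> k2 / k1 * H \<xi>" by (rule normY_le_graph_norm) fact
  also have "\<dots> \<le> k2 / k1 * (k1 / k2 * (r2 * \<epsilon>\<^sup>2))"
    using assms(2) k_pos by (intro mult_left_mono) simp_all
  also have "\<dots> = r2 * \<epsilon>\<^sup>2" using k_pos by simp
  finally show ?thesis using assms(1) by simp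
qed

lemma T_in_B: "\<xi> \<in> B \<Longrightarrow> T \<xi> \<in> B"
  by (rule in_B_I[OF T_in_dom_ker T_bound]) blast+

lemma T_contraction:
  assumes "\<xi> \<in> B" "\<zeta> \<in> B"
  shows "H (T \<xi> - T \<zeta>) \<le> 1 / 2 * H (\<xi> - \<zeta>)"
proof -
  have "\<xi> - \<zeta> \<in> dom_ker n" using assms by (intro dom_ker_closed) blast+
  then have le: "normY (\<xi> - \<zeta>) \<le> k2 / k1 * H (\<xi> - \<zeta>)" by (rule normY_le_graph_norm)
  have s0: "0 \<le> s" using amplitude_nonneg by simp
  have "H (T \<xi> - T \<zeta>) \<le> C\<mu> * (\<bar>\<epsilon>\<bar> * k1 * lip s * normY (\<xi> - \<zeta>))"
    by (rule T_lipschitz[OF assms])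
  also have "\<dots> \<le> C\<mu> * (\<bar>\<epsilon>\<bar> * k1 * lip s * (k2 / k1 * H (\<xi> - \<zeta>)))"
    using C\<mu>_pos k_pos lip_nonneg[OF s0] by (intro mult_left_mono le) simp_all
  also have "\<dots> = (k2 * C\<mu> * \<bar>\<epsilon>\<bar> * lip s) * H (\<xi> - \<zeta>)"
    using k_pos by simp
  also have "\<dots> \<le> 1 / 2 * H (\<xi> - \<zeta>)"
    by (intro mult_right_mono small_contraction graph_norm_nonneg[OF A_linear])
  finally show ?thesis .
qed

section \<open>The Banach fixed point argument\<close>

lemma graph_norm_eq_0: "H x = 0 \<Longrightarrow> x = 0"
  using norm_le_graph_norm[OF A_linear le0, of x n] by simp

lemma T_fixed_point_unique:
  assumes "\<xi> \<in> B" "T \<xi> = \<xi>" "\<zeta> \<in> B" "T \<zeta> = \<zeta>"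
  shows "\<xi> = \<zeta>"
proof -
  have "H (\<xi> - \<zeta>) \<le> 1 / 2 * H (\<xi> - \<zeta>)" using T_contraction[OF assms(1,3)] assms by simp
  then have "H (\<xi> - \<zeta>) = 0" using graph_norm_nonneg[OF A_linear, of n "\<xi> - \<zeta>"] by simp
  then have "\<xi> - \<zeta> = 0" by (rule graph_norm_eq_0)
  then show ?thesis by simp
qed

text \<open>The ball is described by the norm of \<open>Y\<close> but metrized by \<open>H\<close>.
  It is complete because \<open>H\<close> is complete on the domain of the power \<open>n\<close>
  and dominates both the Hilbert space norm, which preserves the kernel condition in the limit, and
  the norm of \<open>Y\<close>, which preserves the radius.\<close>

lemma T_fixed_point_exists: obtains \<xi> where "\<xi> \<in> B" "T \<xi> = \<xi>"
proof -
  have dom: "x \<in> dom_pow D A n" if "x \<in> B" for x using that by blast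
  have minus: "x \<in> B \<Longrightarrow> y \<in> B \<Longrightarrow> x - y \<in> dom_pow D A n" for x y
    by (intro dom_pow_closed[OF A_linear] dom)
  \<comment> \<open>\<open>Metric_space\<close> demands symmetry for all arguments, but
    \<open>H (x - y)\<close> is known to be symmetric only on the domain; hence the value 0 off
    \<open>B\<close>.\<close>
  define d where "d x y = (if x \<in> B \<and> y \<in> B then H (x - y) else 0)" for x y
  interpret M: Metric_space B d
  proof
    show "0 \<le> d x y" for x y by (simp add: d_def graph_norm_nonneg[OF A_linear])
    show "d x y = d y x" for x y
      using graph_norm_minus_commute[OF A_linear dom dom, of x y] by (auto simp: d_def)
    show "d x y = 0 \<longleftrightarrow> x = y" if "x \<in> B" "y \<in> B" for x y
      using that graph_norm_eq_0[of "x - y"] graph_norm_zero[OF A_linear, of n]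
      by (auto simp: d_def)
    show "d x z \<le> d x y + d y z" if "x \<in> B" "y \<in> B" "z \<in> B" for x y z
      using graph_norm_triangle[OF A_linear minus[OF that(1,2)] minus[OF that(2,3)]] that
      by (simp add: d_def)
  qed
  have "M.mcomplete"
    unfolding M.mcomplete_def
  proof (intro allI impI)
    fix X assume "M.MCauchy X"
    then have "range X \<subseteq> B"
      and Cauchy: "\<And>e. e > 0 \<Longrightarrow> \<exists>N. \<forall>i j. N \<le> i \<longrightarrow> N \<le> j \<longrightarrow> d (X i) (X j) < e"
      unfolding M.MCauchy_def by blast+
    then have X: "\<And>i. X i \<in> B" by blast
    have "d (X i) (X j) = H (X i - X j)" for i j using X by (simp only: d_def simp_thms if_True)
    then have C: "\<exists>N. \<forall>i\<ge>N. \<forall>j\<ge>N. H (X i - X j) < e" if "e > 0" for e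
      using Cauchy[OF that] by simp
    obtain x where x: "x \<in> dom_pow D A n" and lim: "(\<lambda>i. H (X i - x)) \<longlonglongrightarrow> 0"
      by (rule graph_norm_complete[OF A_linear A_closed dom[OF X] C])
    have "(\<lambda>i. norm (X i - x)) \<longlonglongrightarrow> 0"
      by (rule tendsto_sandwich[OF _ _ tendsto_const lim])
        (use norm_le_graph_norm[OF A_linear, of 0 n] in simp_all)
    then have "X \<longlonglongrightarrow> x" by (simp add: LIM_zero_iff tendsto_norm_zero_iff)
    then have "(\<lambda>i. cinner (X i) \<psi>0s) \<longlonglongrightarrow> cinner x \<psi>0s"
      by (rule bounded_linear.tendsto[OF bounded_linear_cinner_left])
    moreover have "(\<lambda>i. cinner (X i) \<psi>0s) = (\<lambda>i. 0)" using X by auto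
    ultimately have "cinner x \<psi>0s = 0" using LIMSEQ_unique tendsto_const by metis
    with x have xk: "x \<in> dom_ker n" by simp
    \<comment> \<open>Closedness of the ball: the excess over the radius is bounded by a multiple of
      the \<open>H\<close>-distance to \<open>X i\<close>, which tends to 0.\<close>
    have "normY x \<le> r2 * \<epsilon>\<^sup>2 + k2 / k1 * H (X i - x)" for i
    proof -
      have Xk: "X i \<in> dom_ker n" using X by blast
      have "normY (X i + (x - X i)) \<le> normY (X i) + normY (x - X i)"
        by (intro normY dom_ker_in_Y dom_ker_closed xk Xk)
      moreover have "normY (x - X i) \<le> k2 / k1 * H (x - X i)"
        by (intro normY_le_graph_norm dom_ker_closed xk Xk)
      moreover have "H (x - X i) = H (X i - x)"
        using graph_norm_minus_commute[OF A_linear x dom[OF X]] .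
      ultimately show ?thesis using X[of i] by simp
    qed
    moreover have "(\<lambda>i. r2 * \<epsilon>\<^sup>2 + k2 / k1 * H (X i - x)) \<longlonglongrightarrow> r2 * \<epsilon>\<^sup>2 + k2 / k1 * 0"
      by (intro tendsto_intros lim)
    ultimately have "normY x \<le> r2 * \<epsilon>\<^sup>2 + k2 / k1 * 0"
      by (intro LIMSEQ_le_const) auto
    with xk have xB: "x \<in> B" by simp
    have "limitin M.mtopology X x sequentially"
      unfolding M.limit_metric_sequentially
    proof (intro conjI allI impI xB)
      fix e :: real assume "e > 0"
      then have "\<forall>\<^sub>F i in sequentially. H (X i - x) < e"
        by (rule order_tendstoD(2)[OF lim])
      then show "\<exists>N. \<forall>i\<ge>N. X i \<in> B \<and> d (X i) x < e"
        using X xB by (simp add: d_def eventually_sequentially)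
    qed
    then show "\<exists>x. limitin M.mtopology X x sequentially" ..
  qed
  moreover have "0 \<in> B"
    using dom_ker_closed(4)[of n] r2_pos normY(2)[OF dom_ker_in_Y[OF dom_ker_closed(4)]] by simp
  then have "B \<noteq> {}" by blast
  moreover have "T \<in> B \<rightarrow> B" using T_in_B by blast
  moreover have "d (T x) (T y) \<le> 1 / 2 * d x y" if "x \<in> B" "y \<in> B" for x y
    using T_contraction[OF that] T_in_B[OF that(1)] T_in_B[OF that(2)] that
    by (simp only: d_def if_True simp_thms)
  ultimately show ?thesis
    using M.Banach_fixedpoint_thm[of T "1 / 2"] that by auto
qed

section \<open>From fixed points back to the nonlinear eigenpair\<close>

definition "sigma_of \<xi> = - cinner (increment (shift \<xi>)) \<psi>0s / complex_of_real \<epsilon>"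

text \<open>The factor \<bar>\<epsilon>\<bar> in \<open>s\<close> cancels the division by
  \<epsilon>. So the constraint on \<sigma> holds automatically once \<xi> lies in
  \<open>B\<close>.\<close>

lemma sigma_bound:
  assumes "\<xi> \<in> B"
  shows "cmod (sigma_of \<xi>) \<le> r1"
proof -
  have Y: "shift \<xi> \<in> Y" using assms by (intro dom_ker_in_Y shift_in_dom_ker) blast
  have le: "normY (shift \<xi>) \<le> s" by (rule normY_shift[OF assms])
  have "k1 * L * normY (shift \<xi>) \<le> k1 * L * s"
    using le k_pos L_pos by (intro mult_left_mono) simp_all
  then have "graph_norm A (n - 1) (increment (shift \<xi>)) \<le> k1 * L * s"
    using increment_bound[OF Y] le small_lipschitz by linarith
  from mult_left_mono[OF this onorm_P_nonneg]
  have "cmod (cinner (increment (shift \<xi>)) \<psi>0s) \<le> onorm P * (k1 * L * s)"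
    using cinner_le_graph_norm[of "increment (shift \<xi>)" "n - 1"] by linarith
  also have "\<dots> = \<bar>\<epsilon>\<bar> * (onorm P * k1 * L * amplitude r2 \<epsilon>)" by simp
  also have "\<dots> \<le> \<bar>\<epsilon>\<bar> * r1" by (intro mult_left_mono small_sigma) simp
  finally show ?thesis
    using \<epsilon>_nonzero by (simp add: sigma_of_def norm_divide divide_le_eq mult.commute)
qed

text \<open>The system places \<xi> only in \<open>D\<close> and \<open>Y\<close>, whereas
  \<open>B\<close> asks for the domain of the power \<open>n\<close>. The equation closes the gap:
  its right-hand side has order \<open>n - 1\<close> and \<open>R\<close> adds one. Uniqueness in
  \<open>B\<close> is thus uniqueness in the larger class.\<close>

lemma corrector_iff:
  "corrector D A f Y normY \<mu>0 \<psi>0 \<psi>0s r1 r2 \<epsilon> (\<sigma>, \<xi>) \<longleftrightarrow> \<xi> \<in> B \<and> T \<xi> = \<xi> \<and> \<sigma> = sigma_of \<xi>"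
  (is "?c \<longleftrightarrow> ?t")
proof -
  let ?e = "complex_of_real \<epsilon>"
  have e: "?e \<noteq> 0" using \<epsilon>_nonzero by simp
  have inc: "f (psi_of D A f \<mu>0 \<psi>0 \<psi>0s \<epsilon> \<xi>) - f \<psi>0 = increment (shift \<xi>)"
    by (simp add: psi_of_def increment_def add.assoc)
  have sig: "0 = ?e * \<sigma> + cinner (increment (shift \<xi>)) \<psi>0s \<longleftrightarrow> \<sigma> = sigma_of \<xi>"
    using e by (auto simp: sigma_of_def field_simps eq_neg_iff_add_eq_0)
  have rhs: "?e *\<^sub>C ((\<nu> + ?e * \<sigma>) *\<^sub>C (\<xi> + ?e *\<^sub>C \<phi>) + Q (increment (shift \<xi>))) = rhs \<epsilon> (shift \<xi>)"
    if "\<sigma> = sigma_of \<xi>"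
  proof -
    have "?e * \<sigma> = - cinner (increment (shift \<xi>)) \<psi>0s" using e that by (simp add: sigma_of_def)
    then show ?thesis by (simp add: rhs_def add.commute)
  qed
  have c: "?c \<longleftrightarrow> \<xi> \<in> D \<and> cinner \<xi> \<psi>0s = 0 \<and> \<xi> \<in> Y \<and> cmod \<sigma> \<le> r1 \<and> normY \<xi> \<le> r2 * \<epsilon>\<^sup>2 \<and>
      \<sigma> = sigma_of \<xi> \<and> A \<xi> - \<mu>0 *\<^sub>C \<xi> = rhs \<epsilon> (shift \<xi>)"
    unfolding corrector_def Let_def prod.case inc sig
    using rhs by (auto simp: proj_Q_image_D reduced_op_eq)
  show ?thesis
  proof
    assume ?c
    with c have \<xi>: "\<xi> \<in> D" "cinner \<xi> \<psi>0s = 0" "\<xi> \<in> Y" "normY \<xi> \<le> r2 * \<epsilon>\<^sup>2" "\<sigma> = sigma_of \<xi>"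
      and eq: "A \<xi> - \<mu>0 *\<^sub>C \<xi> = rhs \<epsilon> (shift \<xi>)" by blast+
    have "\<phi> \<in> Y" "cinner \<phi> \<psi>0s = 0" using phi_equation dom_ker_in_Y by blast+
    then have "rhs \<epsilon> (shift \<xi>) \<in> dom_ker (n - 1)"
      using \<xi> by (intro rhs_in_dom_ker) (simp_all add: Y_subspace cinner_add_left cinner_scaleC_left)
    moreover have T: "T \<xi> = \<xi>" using reduced_inverse_left[OF \<xi>(1,2)] by (simp add: T_def eq)
    ultimately have "\<xi> \<in> dom_ker n" using reduced_inverse_dom_ker[of "rhs \<epsilon> (shift \<xi>)"]
      by (simp add: T_def)
    with \<xi> T show ?t by simp
  next
    assume t: ?t
    then have k: "\<xi> \<in> dom_ker n" by blast
    have "cinner (rhs \<epsilon> (shift \<xi>)) \<psi>0s = 0" using rhs_shift_in_dom_ker[OF k] by blast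
    from reduced_inverse[OF this] have "\<xi> \<in> D" "A \<xi> - \<mu>0 *\<^sub>C \<xi> = rhs \<epsilon> (shift \<xi>)"
      using t by (simp_all add: T_def)
    with t sigma_bound[of \<xi>] dom_ker_in_Y[OF k] show ?c unfolding c by simp
  qed
qed

lemma corrector_ex1: "\<exists>!p. corrector D A f Y normY \<mu>0 \<psi>0 \<psi>0s r1 r2 \<epsilon> p"
proof -
  obtain \<xi> where \<xi>: "\<xi> \<in> B" "T \<xi> = \<xi>" by (rule T_fixed_point_exists)
  show ?thesis
  proof (rule ex1I[of _ "(sigma_of \<xi>, \<xi>)"])
    show "corrector D A f Y normY \<mu>0 \<psi>0 \<psi>0s r1 r2 \<epsilon> (sigma_of \<xi>, \<xi>)"
      using \<xi> by (simp add: corrector_iff)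
    show "p = (sigma_of \<xi>, \<xi>)" if "corrector D A f Y normY \<mu>0 \<psi>0 \<psi>0s r1 r2 \<epsilon> p" for p
      using that T_fixed_point_unique[OF \<xi>] by (cases p) (auto simp: corrector_iff)
  qed
qed

lemma nonlinear_eigenpair_eq:
  assumes "\<xi> \<in> B" "T \<xi> = \<xi>"
  shows "nonlinear_eigenpair D A f Y normY \<mu>0 \<psi>0 \<psi>0s r1 r2 \<epsilon> =
    (\<mu>0 + complex_of_real \<epsilon> * \<nu> + (complex_of_real \<epsilon>)\<^sup>2 * sigma_of \<xi>, psi_of D A f \<mu>0 \<psi>0 \<psi>0s \<epsilon> \<xi>)"
proof -
  have "(THE p. corrector D A f Y normY \<mu>0 \<psi>0 \<psi>0s r1 r2 \<epsilon> p) = (sigma_of \<xi>, \<xi>)"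
    using assms by (intro the1_equality corrector_ex1) (simp add: corrector_iff)
  then show ?thesis using \<epsilon>_nonzero by (simp add: nonlinear_eigenpair_def Let_def)
qed

text \<open>With \<open>c\<close> the pairing of the increment with \<open>\<psi>0s\<close>, the
  term -c \<open>\<psi>0\<close> left by \<open>Q\<close> joins \<nu> \<open>\<psi>0\<close> from
  the equation of \<phi>. This completes (\<nu> - c) u to (\<nu> - c) \<psi>, and \<epsilon> (\<nu>
  - c) is the shift of the eigenvalue.\<close>

lemma eigenpair_equation:
  assumes "\<xi> \<in> B" "T \<xi> = \<xi>"
  defines "\<psi> \<equiv> psi_of D A f \<mu>0 \<psi>0 \<psi>0s \<epsilon> \<xi>"
    and "\<mu> \<equiv> \<mu>0 + complex_of_real \<epsilon> * \<nu> + (complex_of_real \<epsilon>)\<^sup>2 * sigma_of \<xi>"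
  shows "\<psi> \<in> D \<inter> Y" "A \<psi> - \<mu> *\<^sub>C \<psi> - complex_of_real \<epsilon> *\<^sub>C f \<psi> = 0" "cinner \<psi> \<psi>0s = 1"
proof -
  let ?e = "complex_of_real \<epsilon>"
  have k: "\<xi> \<in> dom_ker n" using assms(1) by blast
  have D: "x \<in> D" if "x \<in> dom_ker n" for x
    using that n_ge_1 by (auto simp: dom_pow_iff[OF A_linear] dest: spec[of _ 0])
  define u where "u = shift \<xi>"
  have u: "u \<in> dom_ker n" unfolding u_def by (rule shift_in_dom_ker[OF k])
  have \<psi>: "\<psi> = \<psi>0 + u" by (simp add: \<psi>_def psi_of_def u_def add.assoc)
  show "\<psi> \<in> D \<inter> Y"
    using D[OF u] dom_ker_in_Y[OF u] by (simp add: \<psi> A_simps \<psi>0_eigen Y_subspace \<psi>0_in_Y)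
  show "cinner \<psi> \<psi>0s = 1" using u by (simp add: \<psi> cinner_add_left normalized)
  define c where "c = cinner (increment u) \<psi>0s"
  have "?e\<^sup>2 * sigma_of \<xi> = - ?e * c"
    using \<epsilon>_nonzero by (simp add: sigma_of_def c_def u_def power2_eq_square)
  then have \<mu>: "\<mu> = \<mu>0 + ?e * (\<nu> - c)" by (simp add: \<mu>_def algebra_simps)
  have f: "f \<psi> = f \<psi>0 + increment u" by (simp add: \<psi> increment_def)
  have A\<phi>: "A \<phi> = \<mu>0 *\<^sub>C \<phi> + (\<nu> *\<^sub>C \<psi>0 + f \<psi>0)"
    using phi_equation(2) by (simp add: diff_eq_eq add.commute)
  have rhs: "rhs \<epsilon> u = ?e *\<^sub>C ((\<nu> - c) *\<^sub>C u + (increment u - c *\<^sub>C \<psi>0))"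
    by (simp add: rhs_def proj_Q_def proj_P_def c_def)
  have "cinner (rhs \<epsilon> u) \<psi>0s = 0" using rhs_shift_in_dom_ker[OF k] by (simp add: u_def)
  from reduced_inverse(3)[OF this] have A\<xi>: "A \<xi> = \<mu>0 *\<^sub>C \<xi> + rhs \<epsilon> u"
    using assms(2) by (simp add: T_def u_def diff_eq_eq add.commute)
  have "A u = ?e *\<^sub>C A \<phi> + A \<xi>"
    unfolding u_def by (simp add: A_simps D[OF k] D[OF phi_equation(1)])
  also have "\<dots> = \<mu>0 *\<^sub>C u + ?e *\<^sub>C (\<nu> *\<^sub>C \<psi>0 + f \<psi>0) + rhs \<epsilon> u"
    unfolding A\<phi> A\<xi> u_def by (simp add: scaleC_add_right mult.commute add_ac)
  finally have "A \<psi> = \<mu>0 *\<^sub>C \<psi>0 + (\<mu>0 *\<^sub>C u + ?e *\<^sub>C (\<nu> *\<^sub>C \<psi>0 + f \<psi>0) + rhs \<epsilon> u)"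
    by (simp add: \<psi> A_simps D[OF u] \<psi>0_eigen)
  then show "A \<psi> - \<mu> *\<^sub>C \<psi> - ?e *\<^sub>C f \<psi> = 0"
    unfolding rhs f \<mu> unfolding \<psi>
    by (simp add: scaleC_add_right scaleC_add_left complex_space.scale_right_diff_distrib
        complex_space.scale_left_diff_distrib right_diff_distrib)
qed

end

end

section \<open>Antilinear symmetry\<close>

locale symmetric_assumption = basic_assumption +
  fixes \<C> :: "'a \<Rightarrow> 'a"
  assumes symmetry: "antilinear_symmetry D A Y f \<C>"
    and \<mu>0_real: "\<mu>0 \<in> \<real>" and \<psi>0_symmetric: "\<C> \<psi>0 = \<psi>0"
begin

lemma conj_cinner: "cinner (\<C> x) (\<C> y) = cinner y x"
  and conj_D: "x \<in> D \<Longrightarrow> \<C> x \<in> D" and conj_A: "x \<in> D \<Longrightarrow> A (\<C> x) = \<C> (A x)"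
  and conj_f: "x \<in> Y \<Longrightarrow> \<C> (f x) = f (\<C> x)"
  using symmetry
  by (simp_all add: antilinear_symmetry_def antilinear_isometric_involution_def)

lemma conj_add: "\<C> (x + y) = \<C> x + \<C> y"
  and conj_scaleC: "\<C> (c *\<^sub>C x) = cnj c *\<^sub>C \<C> x"
proof -
  have *: "\<C> (c *\<^sub>C x + y) = cnj c *\<^sub>C \<C> x + \<C> y" for c x y
    using symmetry by (simp add: antilinear_symmetry_def antilinear_isometric_involution_def)
  show "\<C> (x + y) = \<C> x + \<C> y" using *[of 1 x y] by simp
  have "\<C> 0 = 0" using *[of 1 0 0] by simp
  then show "\<C> (c *\<^sub>C x) = cnj c *\<^sub>C \<C> x" using *[of c x 0] by simp
qed

lemma conj_diff: "\<C> (x - y) = \<C> x - \<C> y"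
  using conj_add[of "x - y" y] by (simp add: eq_diff_eq)

lemma norm_conj: "norm (\<C> x) = norm x"
proof -
  have "complex_of_real ((norm (\<C> x))\<^sup>2) = complex_of_real ((norm x)\<^sup>2)"
    by (simp only: cinner_self[symmetric] conj_cinner)
  then have "(norm (\<C> x))\<^sup>2 = (norm x)\<^sup>2" using of_real_eq_iff by blast
  then show ?thesis by (simp add: power2_eq_iff_nonneg)
qed

lemma cnj_\<mu>0: "cnj \<mu>0 = \<mu>0"
  using \<mu>0_real by (simp add: Reals_cnj_iff)

text \<open>\<open>\<psi>\<^sub>0\<^sup>*\<close> is \<open>\<C>\<close>-symmetric: the functional it represents is determined by its kernel, the
  range of \<open>A - \<mu>\<^sub>0\<close>, and its value at \<open>\<psi>\<^sub>0\<close>.\<close>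

lemma cinner_conj: "cinner (\<C> x) \<psi>0s = cnj (cinner x \<psi>0s)"
proof -
  obtain y where y: "y \<in> D" and x: "x = cinner x \<psi>0s *\<^sub>C \<psi>0 + (A y - \<mu>0 *\<^sub>C y)"
    by (rule range_decomposition)
  have "\<C> x = cnj (cinner x \<psi>0s) *\<^sub>C \<psi>0 + (A (\<C> y) - \<mu>0 *\<^sub>C \<C> y)"
    by (subst x) (simp add: conj_add conj_diff conj_scaleC \<psi>0_symmetric conj_A y cnj_\<mu>0)
  then show ?thesis
    by (simp add: cinner_add_left cinner_scaleC_left normalized cinner_range conj_D y)
qed

lemma conj_funpow:
  assumes "x \<in> dom_pow D A m" "k \<le> m"
  shows "(A ^^ k) (\<C> x) = \<C> ((A ^^ k) x)"
  using assms by (induction k) (simp_all add: dom_pow_iff[OF A_linear] conj_A)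

lemma conj_dom_pow: "x \<in> dom_pow D A m \<Longrightarrow> \<C> x \<in> dom_pow D A m"
  unfolding dom_pow_iff[OF A_linear, of "\<C> x"]
  by (simp add: conj_funpow[of x m]) (simp add: dom_pow_iff[OF A_linear] conj_D)

lemma conj_dom_ker: "x \<in> dom_ker m \<Longrightarrow> \<C> x \<in> dom_ker m"
  by (simp add: conj_dom_pow cinner_conj)

lemma graph_norm_conj: "x \<in> dom_pow D A m \<Longrightarrow> graph_norm A m (\<C> x) = graph_norm A m x"
  unfolding graph_norm_def by (rule sum.cong) (simp_all add: conj_funpow norm_conj)

text \<open>Applying \<open>\<C>\<close> to the equation for \<open>R \<eta>\<close> exhibits
  \<open>\<C> (R \<eta>)\<close> as a preimage of \<open>\<C> \<eta>\<close>, where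
  \<open>\<mu>0\<close> being real is essential; uniqueness of preimages does the rest.\<close>

lemma conj_reduced_inverse:
  assumes "cinner \<eta> \<psi>0s = 0"
  shows "\<C> (R \<eta>) = R (\<C> \<eta>)"
proof -
  note R = reduced_inverse[OF assms]
  have "A (\<C> (R \<eta>)) - \<mu>0 *\<^sub>C \<C> (R \<eta>) = \<C> (A (R \<eta>) - \<mu>0 *\<^sub>C R \<eta>)"
    by (simp add: conj_A R(1) conj_diff conj_scaleC cnj_\<mu>0)
  also have "\<dots> = \<C> \<eta>" by (simp only: R(3))
  finally have "A (\<C> (R \<eta>)) - \<mu>0 *\<^sub>C \<C> (R \<eta>) = \<C> \<eta>" .
  then show ?thesis
    using reduced_inverse_left[of "\<C> (R \<eta>)"] by (simp add: R conj_D cinner_conj)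
qed

lemma conj_f_\<psi>0: "\<C> (f \<psi>0) = f \<psi>0"
  by (simp add: conj_f \<psi>0_in_Y \<psi>0_symmetric)

lemma cnj_nu: "cnj \<nu> = \<nu>"
  using cinner_conj[of "f \<psi>0"] by (simp add: nu_def conj_f_\<psi>0)

lemma conj_phi: "\<C> \<phi> = \<phi>"
proof -
  have \<phi>: "\<phi> \<in> D" "cinner \<phi> \<psi>0s = 0"
    using phi_equation(1) dom_pow_antimono[OF A_linear n_ge_1] by auto
  have "A (\<C> \<phi>) - \<mu>0 *\<^sub>C \<C> \<phi> = \<C> (A \<phi> - \<mu>0 *\<^sub>C \<phi>)"
    by (simp add: conj_A \<phi> conj_diff conj_scaleC cnj_\<mu>0)
  also have "\<dots> = A \<phi> - \<mu>0 *\<^sub>C \<phi>"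
    unfolding phi_equation(2)
    by (simp add: conj_add conj_scaleC cnj_nu \<psi>0_symmetric conj_f_\<psi>0)
  finally show ?thesis
    using reduced_inverse_left[OF \<phi>] reduced_inverse_left[of "\<C> \<phi>"]
    by (simp add: \<phi> conj_D cinner_conj)
qed

lemma conj_increment: "u \<in> Y \<Longrightarrow> \<C> (increment u) = increment (\<C> u)"
  by (simp add: increment_def conj_diff conj_f conj_add \<psi>0_symmetric Y_subspace \<psi>0_in_Y)

lemma conj_proj_Q: "\<C> (Q x) = Q (\<C> x)"
  by (simp add: proj_Q_def proj_P_def conj_diff conj_scaleC \<psi>0_symmetric cinner_conj)

lemma conj_rhs: "u \<in> Y \<Longrightarrow> \<C> (rhs \<epsilon> u) = rhs \<epsilon> (\<C> u)"
  using cinner_conj[of "increment u"]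
  by (simp add: rhs_def conj_scaleC conj_add conj_proj_Q cnj_nu conj_increment)

end

locale small_symmetric = small_parameter + symmetric_assumption
begin

text \<open>\<open>\<C>\<close> need not preserve the norm of \<open>\<Y>\<close>, so that \<open>\<C> \<xi>\<close> lies in the uniqueness region is
  deduced from the graph norm bound, which every fixed point satisfies and \<open>\<C>\<close> does preserve.\<close>

lemma conj_fixed_point:
  assumes "\<xi> \<in> B" "T \<xi> = \<xi>"
  shows "\<C> \<xi> = \<xi>" "sigma_of \<xi> \<in> \<real>"
proof -
  have k: "\<xi> \<in> dom_ker n" using assms(1) by blast
  have Y: "shift \<xi> \<in> Y" by (rule dom_ker_in_Y[OF shift_in_dom_ker[OF k]])
  have shift: "\<C> (shift \<xi>) = shift (\<C> \<xi>)" by (simp add: conj_add conj_scaleC conj_phi)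
  have "cinner (rhs \<epsilon> (shift \<xi>)) \<psi>0s = 0" using rhs_shift_in_dom_ker[OF k] by blast
  then have "\<C> (T \<xi>) = T (\<C> \<xi>)"
    unfolding T_def by (simp only: conj_reduced_inverse conj_rhs[OF Y] shift)
  with assms(2) have T: "T (\<C> \<xi>) = \<C> \<xi>" by simp
  have "H (\<C> \<xi>) \<le> k1 / k2 * (r2 * \<epsilon>\<^sup>2)"
    using T_bound[OF assms(1)] assms(2) graph_norm_conj[of \<xi> n] k by simp
  then have "\<C> \<xi> \<in> B" by (rule in_B_I[OF conj_dom_ker[OF k]])
  from T_fixed_point_unique[OF this T assms] show *: "\<C> \<xi> = \<xi>" .
  \<comment> \<open>\<open>shift \<xi>\<close> is now fixed by \<open>\<C>\<close>, hence so is its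
    increment, and the pairing of a fixed vector with \<open>\<psi>0s\<close> is real.\<close>
  have "cinner (increment (shift \<xi>)) \<psi>0s = cnj (cinner (increment (shift \<xi>)) \<psi>0s)"
    using cinner_conj[of "increment (shift \<xi>)"] by (simp add: conj_increment[OF Y] shift *)
  then show "sigma_of \<xi> \<in> \<real>"
    by (simp add: sigma_of_def Reals_divide Reals_cnj_iff)
qed

lemma nonlinear_eigenpair_symmetric:
  "case nonlinear_eigenpair D A f Y normY \<mu>0 \<psi>0 \<psi>0s r1 r2 \<epsilon> of (\<mu>, \<psi>) \<Rightarrow>
     \<psi> \<in> D \<inter> Y \<and> A \<psi> - \<mu> *\<^sub>C \<psi> - complex_of_real \<epsilon> *\<^sub>C f \<psi> = 0 \<and> cinner \<psi> \<psi>0s = 1 \<and>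
     \<mu> \<in> \<real> \<and> \<C> \<psi> = \<psi>"
proof -
  obtain \<xi> where \<xi>: "\<xi> \<in> B" "T \<xi> = \<xi>" by (rule T_fixed_point_exists)
  have "\<nu> \<in> \<real>" by (simp add: Reals_cnj_iff cnj_nu)
  then have "\<mu>0 + complex_of_real \<epsilon> * \<nu> + (complex_of_real \<epsilon>)\<^sup>2 * sigma_of \<xi> \<in> \<real>"
    using \<mu>0_real conj_fixed_point(2)[OF \<xi>] by (intro Reals_add Reals_mult Reals_power) simp_all
  moreover have "\<C> (psi_of D A f \<mu>0 \<psi>0 \<psi>0s \<epsilon> \<xi>) = psi_of D A f \<mu>0 \<psi>0 \<psi>0s \<epsilon> \<xi>"
    by (simp add: psi_of_def conj_add conj_scaleC conj_phi \<psi>0_symmetric conj_fixed_point(1)[OF \<xi>])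
  ultimately show ?thesis
    unfolding nonlinear_eigenpair_eq[OF \<xi>] prod.case using eigenpair_equation[OF \<xi>] by blast
qed

end

section \<open>Choice of the threshold for \<epsilon> and conclusion\<close>

theorem theorem4p4:
  fixes D :: "'h::complex_hilbert set" and A f \<C> :: "'h \<Rightarrow> 'h"
    and Y :: "'h set" and normY :: "'h \<Rightarrow> real" and n :: nat
    and k1 k2 rL L C\<mu> r1 r2 :: real and \<mu>0 :: complex and \<psi>0 \<psi>0s :: 'h
  assumes basic: "basic_assumption D A f Y normY n k1 k2 \<mu>0 \<psi>0 \<psi>0s rL L"
    and symmetry: "antilinear_symmetry D A Y f \<C>"
    and \<mu>0_real: "\<mu>0 \<in> \<real>"
    and \<psi>0_symmetric: "\<C> \<psi>0 = \<psi>0"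
    and C\<mu>_pos: "0 < C\<mu>"
    and C\<mu>_bound: "\<And>\<eta>. \<eta> \<in> proj_Q \<psi>0 \<psi>0s ` dom_pow D A (n - 1) \<Longrightarrow>
      graph_norm A n (reduced_inverse D A \<mu>0 \<psi>0 \<psi>0s \<eta>) \<le> C\<mu> * graph_norm A (n - 1) \<eta>"
    and r_pos: "0 < r1" "0 < r2"
    and r1_large:
      "r1 > k1 * L * onorm (proj_P \<psi>0 \<psi>0s) * normY (phi D A f \<mu>0 \<psi>0 \<psi>0s)"
    and r2_large:
      "r2 > k2 * C\<mu> * (cmod (nu f \<psi>0 \<psi>0s) + onorm (proj_Q \<psi>0 \<psi>0s) * L) *
         normY (phi D A f \<mu>0 \<psi>0 \<psi>0s)"
  shows "\<exists>\<epsilon>0>0. \<forall>\<epsilon>\<in>{-\<epsilon>0<..<\<epsilon>0}.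
    (\<epsilon> \<noteq> 0 \<longrightarrow> (\<exists>!p. corrector D A f Y normY \<mu>0 \<psi>0 \<psi>0s r1 r2 \<epsilon> p)) \<and>
    (case nonlinear_eigenpair D A f Y normY \<mu>0 \<psi>0 \<psi>0s r1 r2 \<epsilon> of (\<mu>, \<psi>) \<Rightarrow>
       \<psi> \<in> D \<inter> Y \<and> A \<psi> - \<mu> *\<^sub>C \<psi> - complex_of_real \<epsilon> *\<^sub>C f \<psi> = 0 \<and> cinner \<psi> \<psi>0s = 1 \<and>
       \<mu> \<in> \<real> \<and> \<C> \<psi> = \<psi>)"
proof -
  interpret basic_assumption D A f Y normY n k1 k2 \<mu>0 \<psi>0 \<psi>0s rL L by (fact basic)
  let ?a = "amplitude r2"
  \<comment> \<open>All four conditions are strict inequalities between limits at 0, hence hold for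
    small nonzero \<epsilon>. The limits of \<open>?a\<close> and \<open>lip\<close> are
    \<open>normY \<phi>\<close> and \<open>lip 0\<close>, so conditions \<open>2\<close> and
    \<open>4\<close> are the hypotheses on \<open>r2\<close> and \<open>r1\<close>.\<close>
  have amp: "(?a \<longlongrightarrow> normY \<phi> + r2 * \<bar>0\<bar>) (at 0)"
    unfolding amplitude_def by (intro tendsto_intros)
  have s: "((\<lambda>\<epsilon>. \<bar>\<epsilon>\<bar> * ?a \<epsilon>) \<longlongrightarrow> \<bar>0\<bar> * (normY \<phi> + r2 * \<bar>0\<bar>)) (at 0)"
    by (intro tendsto_intros amp)
  have lip: "((\<lambda>\<epsilon>. lip (\<bar>\<epsilon>\<bar> * ?a \<epsilon>)) \<longlongrightarrow> lip (\<bar>0\<bar> * (normY \<phi> + r2 * \<bar>0\<bar>))) (at 0)"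
    unfolding lip_def by (intro tendsto_intros s)
  have 1: "\<forall>\<^sub>F \<epsilon> in at 0. \<bar>\<epsilon>\<bar> * ?a \<epsilon> < rL"
    using L_pos by (intro order_tendstoD(2)[OF s]) simp
  have "((\<lambda>\<epsilon>. k2 * C\<mu> * lip (\<bar>\<epsilon>\<bar> * ?a \<epsilon>) * ?a \<epsilon>) \<longlongrightarrow>
      k2 * C\<mu> * lip (\<bar>0\<bar> * (normY \<phi> + r2 * \<bar>0\<bar>)) * (normY \<phi> + r2 * \<bar>0\<bar>)) (at 0)"
    by (intro tendsto_intros amp lip)
  then have 2: "\<forall>\<^sub>F \<epsilon> in at 0. k2 * C\<mu> * lip (\<bar>\<epsilon>\<bar> * ?a \<epsilon>) * ?a \<epsilon> < r2"
    by (rule order_tendstoD(2)) (use r2_large in \<open>simp add: lip_def\<close>)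
  have "((\<lambda>\<epsilon>. k2 * C\<mu> * \<bar>\<epsilon>\<bar> * lip (\<bar>\<epsilon>\<bar> * ?a \<epsilon>)) \<longlongrightarrow>
      k2 * C\<mu> * \<bar>0\<bar> * lip (\<bar>0\<bar> * (normY \<phi> + r2 * \<bar>0\<bar>))) (at 0)"
    by (intro tendsto_intros lip)
  then have 3: "\<forall>\<^sub>F \<epsilon> in at 0. k2 * C\<mu> * \<bar>\<epsilon>\<bar> * lip (\<bar>\<epsilon>\<bar> * ?a \<epsilon>) < 1 / 2"
    by (rule order_tendstoD(2)) simp
  have "((\<lambda>\<epsilon>. onorm P * k1 * L * ?a \<epsilon>) \<longlongrightarrow> onorm P * k1 * L * (normY \<phi> + r2 * \<bar>0\<bar>)) (at 0)"
    by (intro tendsto_intros amp)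
  then have 4: "\<forall>\<^sub>F \<epsilon> in at 0. onorm P * k1 * L * ?a \<epsilon> < r1"
    by (rule order_tendstoD(2)) (use r1_large in \<open>simp add: mult_ac\<close>)
  \<comment> \<open>The ball of radius 1 is arbitrary; the fact about it supplies \<epsilon>
    \<noteq> 0.\<close>
  have "\<forall>\<^sub>F \<epsilon> in at 0. small_symmetric D A f Y normY n k1 k2 \<mu>0 \<psi>0 \<psi>0s rL L C\<mu> r1 r2 \<epsilon> \<C>"
    using 1 2 3 4 eventually_at_ball'[OF zero_less_one, of 0 UNIV]
  proof eventually_elim
    case (elim \<epsilon>)
    show ?case
    proof unfold_locales
      show "graph_norm A n (R \<eta>) \<le> C\<mu> * graph_norm A (n - 1) \<eta>" if "\<eta> \<in> dom_ker (n - 1)" for \<eta>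
        using C\<mu>_bound that unfolding proj_Q_image .
    qed (use elim C\<mu>_pos r_pos symmetry \<mu>0_real \<psi>0_symmetric in \<open>simp_all add: less_imp_le\<close>)
  qed
  then obtain \<epsilon>0 where \<epsilon>0: "\<epsilon>0 > 0" and small: "\<And>\<epsilon>. \<epsilon> \<noteq> 0 \<Longrightarrow> \<bar>\<epsilon>\<bar> < \<epsilon>0 \<Longrightarrow>
      small_symmetric D A f Y normY n k1 k2 \<mu>0 \<psi>0 \<psi>0s rL L C\<mu> r1 r2 \<epsilon> \<C>"
    by (auto simp: eventually_at dist_real_def)
  show ?thesis
  proof (intro exI[of _ \<epsilon>0] conjI \<epsilon>0 ballI)
    fix \<epsilon> assume "\<epsilon> \<in> {-\<epsilon>0<..<\<epsilon>0}"
    then have \<epsilon>: "\<bar>\<epsilon>\<bar> < \<epsilon>0" by auto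
    show "\<epsilon> \<noteq> 0 \<longrightarrow> (\<exists>!p. corrector D A f Y normY \<mu>0 \<psi>0 \<psi>0s r1 r2 \<epsilon> p)"
    proof
      assume "\<epsilon> \<noteq> 0"
      from small_parameter.corrector_ex1[OF small_symmetric.axioms(1)[OF small[OF this \<epsilon>]]]
      show "\<exists>!p. corrector D A f Y normY \<mu>0 \<psi>0 \<psi>0s r1 r2 \<epsilon> p" .
    qed
    show "case nonlinear_eigenpair D A f Y normY \<mu>0 \<psi>0 \<psi>0s r1 r2 \<epsilon> of (\<mu>, \<psi>) \<Rightarrow>
       \<psi> \<in> D \<inter> Y \<and> A \<psi> - \<mu> *\<^sub>C \<psi> - complex_of_real \<epsilon> *\<^sub>C f \<psi> = 0 \<and> cinner \<psi> \<psi>0s = 1 \<and>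
       \<mu> \<in> \<real> \<and> \<C> \<psi> = \<psi>"
    proof (cases "\<epsilon> = 0")
      case True
      then show ?thesis
        using \<psi>0_eigen \<psi>0_in_Y normalized \<mu>0_real \<psi>0_symmetric
        by (simp add: nonlinear_eigenpair_def)
    next
      case False
      from small_symmetric.nonlinear_eigenpair_symmetric[OF small[OF False \<epsilon>]] show ?thesis .
    qed
  qed
qed

end
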